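(* Let $\{\omega^{s,t}\}_{s,t\in[0,1]}$ be doubling weights on $\mathbb{T}\otimes\mathbb{T}$ with doubling constants at most $C_{\rm dbl}$, and suppose $(s,t,x,y)\mapsto\omega^{s,t}(x,y)$ is measurable. (1) Fix $1\le p\le\infty$; if $\omega^{s,t}\in A_p^d(\mathbb{T}\otimes\mathbb{T})$ with $A_p^d(\omega^{s,t})\le V_{p,d}$ for all $s,t$, then $\omega(x,y)=\int_0^1\!\int_0^1\omega^{s,t}(x+s,y+t)\,ds\,dt$ belongs to $A_p(\mathbb{T}\otimes\mathbb{T})$ with constant depending only on $p,V_{p,d},C_{\rm dbl}$. (2) Fix $1<p\le\infty$; if $\omega^{s,t}\in RH_p^d(\mathbb{T}\otimes\mathbb{T})$ with $RH_p^d(\omega^{s,t})\le V_{p,d}$ for all $s,t$, then $\omega\in RH_p(\mathbb{T}\otimes\mathbb{T})$ with $RH_p(\omega)$ depending only on $p,V_{p,d},C_{\rm dbl}$.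
   Context: $\mathbb{T}$ is the circle $[0,1]$ with endpoints identified, additions mod 1; $\mathbb{T}\otimes\mathbb{T}=\mathbb{T}^2$. Rectangles $R=Q_1\times Q_2$ ($Q_i$ intervals), dyadic rectangles $I\times J$ ($I,J\in\mathcal{D}=\{[0,1]\}\cup\{[j2^{-k},(j+1)2^{-k})\}$). $\omega$ is doubling with constant $C$ if $\int_{\widetilde Q_1\times\widetilde Q_2}\omega\le C\int_{Q_1\times Q_2}\omega$ for all rectangles, $\widetilde Q$ being the interval with the same midpoint and twice the length. $-\!\!\!\!\!\!\int_E f=\frac1{|E|}\int_Ef$. Product $A_p$, $RH_p$ constants are the one-variable definitions with intervals replaced by rectangles: $A_p(\omega)=\sup_R(-\!\!\!\!\!\!\int_R\omega)(-\!\!\!\!\!\!\int_R\omega^{-1/(p-1)})^{p-1}$ ($1<p<\infty$), $A_1(\omega)=\sup_R(-\!\!\!\!\!\!\int_R\omega)/\operatorname{ess\,inf}_R\omega$, $A_\infty(\omega)=\sup_R(-\!\!\!\!\!\!\int_R\omega)\exp(-\!\!\!\!\!\!\int_R\log(1/\omega))$, $RH_p(\omega)=\sup_R(-\!\!\!\!\!\!\int_R\omega^p)^{1/p}(-\!\!\!\!\!\!\int_R\omega)^{-1}$, $RH_\infty(\omega)=\sup_R(\operatorname{ess\,sup}_R\omega)(-\!\!\!\!\!\!\int_R\omega)^{-1}$. Dyadic versions take suprema over dyadic rectangles; $RH_p^d$ additionally requires dyadic doubling ($\int_{\widetilde I\times\widetilde J}\omega\le C\int_{I\times J}\omega$, $\widetilde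 I$ the dyadic interval of length $2|I|$ containing $I$), with $RH_p^d(\omega)$ the max of the dyadic supremum and this doubling constant.
   Formalization: The map (s,t,x,y)↦ω^{s,t}(x,y) is also assumed integrable over [0,1]^4, so that ω is a weight; without this the claim fails (constant weights ω^{s,t}=1/s satisfy every hypothesis but give ω=∞). *)

theory Defs
  imports "HOL-Analysis.Analysis"
begin

text \<open>Functions on the torus T x T are represented by functions of two real
variables whose values on [0,1) x [0,1) matter; per f is the 1-periodic
extension to the plane (additions mod 1).\<close>

definition per :: "(real \<Rightarrow> real \<Rightarrow> real) \<Rightarrow> real \<times> real \<Rightarrow> real" where
  "per f z = f (frac (fst z)) (frac (snd z))"

definition avg :: "(real \<times> real) set \<Rightarrow> (real \<times> real \<Rightarrow> real) \<Rightarrow> real" where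
  "avg R g = set_lebesgue_integral lebesgue R g / measure lebesgue R"

text \<open>Rectangles of the torus: products of arcs, represented as real intervals of
length in (0,1] (the periodic extension is integrated over them).\<close>

definition torus_rects :: "(real \<times> real) set set" where
  "torus_rects = {{a..a+l} \<times> {b..b+m} | a b l m. 0 < l \<and> l \<le> 1 \<and> 0 < m \<and> m \<le> 1}"

definition dyad :: "nat \<Rightarrow> nat \<Rightarrow> real set" where
  "dyad k j = {real j / 2^k ..< (real j + 1) / 2^k}"

definition dyadic_rects :: "(real \<times> real) set set" where
  "dyadic_rects = {dyad k1 j1 \<times> dyad k2 j2 | k1 j1 k2 j2. j1 < 2^k1 \<and> j2 < 2^k2}"

text \<open>Dyadic parent (index form); the parent of [0,1) is taken to be itself.\<close>

definition dpar :: "nat \<times> nat \<Rightarrow> nat \<times> nat" where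
  "dpar kj = (if fst kj = 0 then (0, 0) else (fst kj - 1, snd kj div 2))"

definition weight :: "(real \<Rightarrow> real \<Rightarrow> real) \<Rightarrow> bool" where
  "weight f \<longleftrightarrow> (\<lambda>z. f (fst z) (snd z)) \<in> borel_measurable lebesgue
     \<and> set_integrable lebesgue ({0..1} \<times> {0..1}) (per f)
     \<and> (AE z in lebesgue. z \<in> {0..1} \<times> {0..1} \<longrightarrow> 0 < per f z)"

definition doubling :: "real \<Rightarrow> (real \<times> real \<Rightarrow> real) \<Rightarrow> bool" where
  "doubling C g \<longleftrightarrow> (\<forall>a b l m. 0 < l \<and> l \<le> 1 \<and> 0 < m \<and> m \<le> 1 \<longrightarrow>
     set_lebesgue_integral lebesgue ({a - l/2 .. a + 3*l/2} \<times> {b - m/2 .. b + 3*m/2}) g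
       \<le> C * set_lebesgue_integral lebesgue ({a..a+l} \<times> {b..b+m}) g)"

definition dyadic_doubling :: "real \<Rightarrow> (real \<times> real \<Rightarrow> real) \<Rightarrow> bool" where
  "dyadic_doubling C g \<longleftrightarrow> (\<forall>k1 j1 k2 j2. j1 < 2^k1 \<and> j2 < 2^k2 \<longrightarrow>
     set_lebesgue_integral lebesgue
        (dyad (fst (dpar (k1,j1))) (snd (dpar (k1,j1))) \<times> dyad (fst (dpar (k2,j2))) (snd (dpar (k2,j2)))) g
       \<le> C * set_lebesgue_integral lebesgue (dyad k1 j1 \<times> dyad k2 j2) g)"

definition Ap_cond :: "ereal \<Rightarrow> real \<Rightarrow> (real \<times> real) set set \<Rightarrow> (real \<times> real \<Rightarrow> real) \<Rightarrow> bool" where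
  "Ap_cond p K Rs g \<longleftrightarrow> (\<forall>R\<in>Rs. set_integrable lebesgue R g \<and>
     (if p = \<infinity> then
        set_integrable lebesgue R (\<lambda>z. ln (1 / g z)) \<and>
        avg R g * exp (avg R (\<lambda>z. ln (1 / g z))) \<le> K
      else if p = 1 then
        (AE z in lebesgue. z \<in> R \<longrightarrow> avg R g \<le> K * g z)
      else
        set_integrable lebesgue R (\<lambda>z. g z powr (-1 / (real_of_ereal p - 1))) \<and>
        avg R g * (avg R (\<lambda>z. g z powr (-1 / (real_of_ereal p - 1)))) powr (real_of_ereal p - 1) \<le> K))"

definition RH_cond :: "ereal \<Rightarrow> real \<Rightarrow> (real \<times> real) set set \<Rightarrow> (real \<times> real \<Rightarrow> real) \<Rightarrow> bool" where
  "RH_cond p K Rs g \<longleftrightarrow> (\<forall>R\<in>Rs. set_integrable lebesgue R g \<and>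
     (if p = \<infinity> then
        (AE z in lebesgue. z \<in> R \<longrightarrow> g z \<le> K * avg R g)
      else
        set_integrable lebesgue R (\<lambda>z. g z powr real_of_ereal p) \<and>
        (avg R (\<lambda>z. g z powr real_of_ereal p)) powr (1 / real_of_ereal p) \<le> K * avg R g))"

definition RHd_cond :: "ereal \<Rightarrow> real \<Rightarrow> (real \<times> real \<Rightarrow> real) \<Rightarrow> bool" where
  "RHd_cond p K g \<longleftrightarrow> RH_cond p K dyadic_rects g \<and> dyadic_doubling K g"

text \<open>The family (s,t,x,y) \<mapsto> W s t x y: jointly measurable, and (implicit in the paper,
so that the average is a weight) integrable over [0,1]^4.\<close>

definition joint_ok :: "(real \<Rightarrow> real \<Rightarrow> real \<Rightarrow> real \<Rightarrow> real) \<Rightarrow> bool" where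
  "joint_ok W \<longleftrightarrow>
     (\<lambda>u. W (fst (fst u)) (snd (fst u)) (fst (snd u)) (snd (snd u)))
        \<in> borel_measurable (lebesgue :: ((real \<times> real) \<times> (real \<times> real)) measure)
   \<and> set_integrable (lebesgue :: ((real \<times> real) \<times> (real \<times> real)) measure)
        (({0..1} \<times> {0..1}) \<times> ({0..1} \<times> {0..1}))
        (\<lambda>u. W (fst (fst u)) (snd (fst u)) (fst (snd u)) (snd (snd u)))"

definition avgw :: "(real \<Rightarrow> real \<Rightarrow> real \<Rightarrow> real \<Rightarrow> real) \<Rightarrow> real \<Rightarrow> real \<Rightarrow> real" where
  "avgw W x y = set_lebesgue_integral lebesgue ({0..1} \<times> {0..1})
      (\<lambda>st. W (fst st) (snd st) (frac (x + fst st)) (frac (y + snd st)))"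

end

theory Submission
  imports Defs "HOL-Probability.Probability_Measure"
begin

text \<open>
  Each of the five conditions on a rectangle \<open>R\<close> bounds a mean over \<open>R\<close> of \<open>\<phi> (g / c)\<close>, where \<open>c\<close>
  is the mean of the weight \<open>g\<close> over \<open>R\<close> and \<open>\<phi> \<ge> 0\<close> is convex on the positive half-line:
  \<open>x powr (-1/(p-1))\<close> for $A_p$, \<open>x - 1 - ln x\<close> for $A_\infty$, \<open>max 0 (1 - K x)\<close> with bound 0 for
  $A_1$, \<open>x powr p\<close> for $RH_p$ and \<open>max 0 (x - K)\<close> with bound 0 for $RH_\infty$.
  For a doubling weight such a bound passes from dyadic to arbitrary rectangles, by covering a rectangle
  with boundedly many comparable dyadic ones, over which the means of \<open>g\<close> are comparable.
  It then passes to averages of translated weights by Jensen's inequality, applied to the probability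
  measure on the parameters whose density is proportional to the mean \<open>c\<close>.
\<close>

subsection \<open>Normalized moments and averages\<close>

text \<open>Normalizing by \<open>c\<close> makes averaging free of loss: the ratio
  \<open>g / c\<close> of the averaged weight is an average, under the reweighted parameters, of the
  ratios of the members. As an integral in \<open>ennreal\<close> of a nonnegative function, the
  moment carries integrability in any finite bound; x - 1 - ln x stands in for - ln x because x - 1
  has mean 0 for x = g / c. The price appears in the covering: on a dyadic D the normalization is
  the mean over D, so \<phi> must survive dilation by the ratio q of two means. This is the
  condition \<psi> (q x) \<le> A \<phi> x + B (x + 1) for 1 / M \<le> q \<le> M. The linear term
  costs 2 B, since x has mean 1; \<psi> differs from \<phi> only for A_1 and RH_infinity, where the
  constant grows by the factor M. The other obstacle is measurability. The members are only Lebesgue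
  measurable, and composing them with \<open>frac\<close> and with the sum of parameter and point is
  not immediately harmless. They are replaced by an everywhere positive Borel version, equal almost
  everywhere where it matters, before Fubini is applied.\<close>

definition normalized_moment :: "(real \<Rightarrow> real) \<Rightarrow> 'a measure \<Rightarrow> ('a \<Rightarrow> real) \<Rightarrow> ennreal" where
  "normalized_moment \<phi> N X = (\<integral>\<^sup>+z. ennreal (\<phi> (X z / (\<integral>x. X x \<partial>N))) \<partial>N)"

context prob_space
begin

text \<open>A power is homogeneous, so \<open>?c powr - a\<close> factors out of the moment; what
  remains is a nonnegative integral, whose finiteness is integrability.\<close>

lemma normalized_moment_powr_le_iff:
  assumes X: "integrable M X" "AE z in M. 0 < X z" and L: "0 \<le> L"
  shows "normalized_moment (\<lambda>x. x powr a) M X \<le> ennreal L \<longleftrightarrow>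
    integrable M (\<lambda>z. X z powr a) \<and> expectation (\<lambda>z. X z powr a) \<le> L * expectation X powr a"
proof -
  have [measurable]: "X \<in> borel_measurable M" using X by auto
  let ?c = "expectation X" and ?I = "\<integral>\<^sup>+z. ennreal (X z powr a) \<partial>M"
  have c: "0 < ?c" by (rule expectation_greater[OF X])
  have "normalized_moment (\<lambda>x. x powr a) M X = (\<integral>\<^sup>+z. ennreal (?c powr - a) * ennreal (X z powr a) \<partial>M)"
    unfolding normalized_moment_def using X(2) c
    by (intro nn_integral_cong_AE) (auto simp: powr_divide powr_minus_divide ennreal_mult[symmetric])
  also have "\<dots> = ennreal (?c powr - a) * ?I"
    by (intro nn_integral_cmult) auto
  finally have eq: "normalized_moment (\<lambda>x. x powr a) M X = ennreal (?c powr - a) * ?I" .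
  show ?thesis
  proof (intro iffI conjI)
    assume le: "normalized_moment (\<lambda>x. x powr a) M X \<le> ennreal L"
    have "?I \<noteq> \<infinity>"
    proof
      assume "?I = \<infinity>"
      then have "ennreal (?c powr - a) * ?I = \<infinity>" using c by (simp add: ennreal_mult_top)
      with le eq show False by (simp add: top_unique)
    qed
    then show i: "integrable M (\<lambda>z. X z powr a)"
      by (intro integrableI_nonneg) (auto simp: top.not_eq_extremum)
    have "?I = ennreal (expectation (\<lambda>z. X z powr a))"
      using i by (intro nn_integral_eq_integral) auto
    then have "ennreal (?c powr - a * expectation (\<lambda>z. X z powr a)) \<le> ennreal L"
      using le eq by (simp add: ennreal_mult)
    then show "expectation (\<lambda>z. X z powr a) \<le> L * ?c powr a"
      using L c by (simp add: powr_minus field_simps)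
  next
    assume *: "integrable M (\<lambda>z. X z powr a) \<and> expectation (\<lambda>z. X z powr a) \<le> L * ?c powr a"
    then have "?I = ennreal (expectation (\<lambda>z. X z powr a))"
      by (intro nn_integral_eq_integral) auto
    then have "normalized_moment (\<lambda>x. x powr a) M X = ennreal (?c powr - a * expectation (\<lambda>z. X z powr a))"
      using eq by (simp add: ennreal_mult)
    also have "\<dots> \<le> ennreal L" using * L c by (intro ennreal_leI) (simp add: powr_minus field_simps)
    finally show "normalized_moment (\<lambda>x. x powr a) M X \<le> ennreal L" .
  qed
qed

text \<open>The part X / c - 1 integrates to 0, so the moment equals ln c plus the mean of ln (1 /
  X); \<open>exp\<close> turns its bound into the A_infinity product.\<close>

lemma normalized_moment_ln_le_iff:
  assumes X: "integrable M X" "AE z in M. 0 < X z" and L: "0 \<le> L"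
  shows "normalized_moment (\<lambda>x. x - 1 - ln x) M X \<le> ennreal L \<longleftrightarrow>
    integrable M (\<lambda>z. ln (1 / X z)) \<and> expectation X * exp (expectation (\<lambda>z. ln (1 / X z))) \<le> exp L"
proof -
  have [measurable]: "X \<in> borel_measurable M" using X by auto
  let ?c = "expectation X" and ?f = "\<lambda>z. X z / expectation X - 1 - ln (X z / expectation X)"
  have c: "0 < ?c" by (rule expectation_greater[OF X])
  have ln: "AE z in M. ?f z = X z / ?c - 1 + ln ?c + ln (1 / X z)"
    using X(2)
  proof eventually_elim
    case (elim z)
    then show ?case using c by (simp add: ln_div)
  qed
  have nonneg: "AE z in M. 0 \<le> ?f z"
    using X(2)
  proof eventually_elim
    case (elim z)
    then show ?case using ln_le_minus_one[of "X z / ?c"] c by simp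
  qed
  have fX: "integrable M (\<lambda>z. X z / ?c - 1 + ln ?c)"
    using X by auto
  have i_iff: "integrable M ?f \<longleftrightarrow> integrable M (\<lambda>z. ln (1 / X z))"
  proof -
    have "integrable M ?f \<longleftrightarrow> integrable M (\<lambda>z. (X z / ?c - 1 + ln ?c) + ln (1 / X z))"
      using ln by (intro integrable_cong_AE) auto
    also have "\<dots> \<longleftrightarrow> integrable M (\<lambda>z. ln (1 / X z))"
      using Bochner_Integration.integrable_diff[OF _ fX, of "\<lambda>z. (X z / ?c - 1 + ln ?c) + ln (1 / X z)"]
        Bochner_Integration.integrable_add[OF fX, of "\<lambda>z. ln (1 / X z)"] by auto
    finally show ?thesis .
  qed
  have e: "expectation ?f = ln ?c + expectation (\<lambda>z. ln (1 / X z))"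
    if "integrable M (\<lambda>z. ln (1 / X z))"
  proof -
    have "expectation ?f = expectation (\<lambda>z. (X z / ?c - 1 + ln ?c) + ln (1 / X z))"
      using ln by (intro integral_cong_AE) auto
    also have "\<dots> = expectation (\<lambda>z. X z / ?c - 1 + ln ?c) + expectation (\<lambda>z. ln (1 / X z))"
      using that fX by (rule Bochner_Integration.integral_add[rotated])
    also have "expectation (\<lambda>z. X z / ?c - 1 + ln ?c) = ln ?c"
      using X c by (simp add: prob_space)
    finally show ?thesis .
  qed
  have exp_iff: "?c * exp y \<le> exp L \<longleftrightarrow> ln ?c + y \<le> L" for y
  proof -
    have "?c * exp y = exp (ln ?c + y)" using c by (simp add: exp_add)
    then show ?thesis by simp
  qed
  have eqi: "normalized_moment (\<lambda>x. x - 1 - ln x) M X = ennreal (expectation ?f)" if "integrable M ?f"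
    unfolding normalized_moment_def using that nonneg by (intro nn_integral_eq_integral) auto
  show ?thesis
  proof (intro iffI)
    assume le: "normalized_moment (\<lambda>x. x - 1 - ln x) M X \<le> ennreal L"
    then have "(\<integral>\<^sup>+z. ennreal (?f z) \<partial>M) < \<infinity>"
      unfolding normalized_moment_def by (auto simp: le_less_trans)
    then have i: "integrable M ?f"
      using nonneg by (intro integrableI_nonneg) auto
    then show "integrable M (\<lambda>z. ln (1 / X z)) \<and> ?c * exp (expectation (\<lambda>z. ln (1 / X z))) \<le> exp L"
      using le i_iff e eqi L by (auto simp: exp_iff)
  next
    assume *: "integrable M (\<lambda>z. ln (1 / X z)) \<and> ?c * exp (expectation (\<lambda>z. ln (1 / X z))) \<le> exp L"
    then show "normalized_moment (\<lambda>x. x - 1 - ln x) M X \<le> ennreal L"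
      using i_iff e eqi by (auto simp: exp_iff ennreal_leI)
  qed
qed

text \<open>A nonnegative integral vanishes only if its integrand does almost everywhere. This is
  how the essential bounds in A_1 and RH_infinity become moment conditions.\<close>

lemma normalized_moment_le_0_iff:
  assumes X: "X \<in> borel_measurable M" "\<phi> \<in> borel_measurable borel"
  shows "normalized_moment \<phi> M X \<le> 0 \<longleftrightarrow> (AE z in M. \<phi> (X z / expectation X) \<le> 0)"
proof -
  note [measurable] = X
  show ?thesis
    unfolding normalized_moment_def
    by (subst le_zero_eq, subst nn_integral_0_iff_AE) (auto simp: ennreal_eq_0_iff)
qed

end

section \<open>Convexity and Jensen's inequality over the parameters\<close>

lemma convex_on_powr_nonpos:
  assumes "a \<le> (0::real)" shows "convex_on {0<..} (\<lambda>x. x powr a)"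
proof (rule f''_ge0_imp_convex)
  show "convex {(0::real)<..}" by auto
  show "((\<lambda>x. x powr a) has_real_derivative a * x powr (a - 1)) (at x)" if "x \<in> {0<..}" for x
    using that by (auto intro!: derivative_eq_intros)
  show "((\<lambda>x. a * x powr (a - 1)) has_real_derivative a * ((a - 1) * x powr (a - 2))) (at x)" if "x \<in> {0<..}" for x
    using that by (auto intro!: derivative_eq_intros simp: algebra_simps)
  show "0 \<le> a * ((a - 1) * x powr (a - 2))" for x :: real
    using assms by (simp add: mult_nonpos_nonpos mult_nonpos_nonneg)
qed

text \<open>Let Q have density c s / cb with respect to P. Then h (s, z) / c s has Q-mean G z / cb,
  because c s cancels. Jensen in s for almost every z, followed by Tonelli, leaves the constant K
  unchanged.\<close>

lemma normalized_moment_average_le: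
  fixes h :: "'a \<times> 'b \<Rightarrow> real"
  assumes P: "prob_space P" and N: "prob_space N"
    and h[measurable]: "h \<in> borel_measurable (P \<Otimes>\<^sub>M N)"
    and hi: "integrable (P \<Otimes>\<^sub>M N) h"
    and pos: "\<And>u. 0 < h u"
    and \<phi>[measurable]: "\<phi> \<in> borel_measurable borel" and convex: "convex_on {0<..} \<phi>"
    and nonneg: "\<And>x. 0 < x \<Longrightarrow> 0 \<le> \<phi> x"
    and le: "AE s in P. normalized_moment \<phi> N (\<lambda>z. h (s, z)) \<le> ennreal K"
  shows "normalized_moment \<phi> N (\<lambda>z. \<integral>s. h (s, z) \<partial>P) \<le> ennreal K"
proof -
  interpret P: prob_space P by fact
  interpret N: prob_space N by fact
  interpret PN: pair_prob_space P N ..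
  define c where "c s = (\<integral>z. h (s, z) \<partial>N)" for s
  define G where "G z = (\<integral>s. h (s, z) \<partial>P)" for z
  have [measurable]: "c \<in> borel_measurable P" unfolding c_def by measurable
  have [measurable]: "G \<in> borel_measurable N" unfolding G_def by measurable
  have ci: "integrable P c" unfolding c_def by (rule PN.integrable_fst'[OF hi])
  have Gi: "integrable N G" unfolding G_def using PN.integrable_snd[of "\<lambda>s z. h (s, z)"] hi by simp
  define cb where "cb = (\<integral>s. c s \<partial>P)"
  have GE: "(\<integral>z. G z \<partial>N) = cb"
    unfolding cb_def G_def c_def using PN.Fubini_integral[of "\<lambda>s z. h (s, z)"] hi by simp
  \<comment> \<open>Only almost every section is known to be integrable; elsewhere the Bochner
    integral c s may be the default 0.\<close>
  have cpos: "AE s in P. 0 < c s"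
    using PN.AE_integrable_fst'[OF hi]
  proof eventually_elim
    case (elim s)
    then show ?case unfolding c_def by (intro N.expectation_greater) (auto simp: pos)
  qed
  have cb: "0 < cb" unfolding cb_def by (rule P.expectation_greater[OF ci cpos])
  define Q where "Q = density P (\<lambda>s. ennreal (c s / cb))"
  have [measurable_cong]: "sets Q = sets P" by (simp add: Q_def)
  have emQ: "emeasure Q (space Q) = 1"
  proof -
    have "emeasure Q (space Q) = (\<integral>\<^sup>+s. ennreal (c s / cb) \<partial>P)"
      unfolding Q_def by (simp add: emeasure_density cong: nn_integral_cong)
    also have "\<dots> = ennreal (\<integral>s. c s / cb \<partial>P)"
      using ci cb cpos by (intro nn_integral_eq_integral) (auto elim!: eventually_mono)
    also have "\<dots> = 1" using cb cb_def by simp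
    finally show ?thesis .
  qed
  interpret Q: prob_space Q by (rule prob_spaceI) fact
  interpret QN: pair_prob_space Q N ..
  have AEQ: "AE s in Q. R s" if "AE s in P. R s" for R
    unfolding Q_def using that by (subst AE_density) auto
  have swap: "(\<integral>\<^sup>+z. \<integral>\<^sup>+s. ennreal (\<phi> (h (s, z) / c s)) \<partial>Q \<partial>N) \<le> ennreal K"
  proof -
    have "(\<integral>\<^sup>+z. \<integral>\<^sup>+s. ennreal (\<phi> (h (s, z) / c s)) \<partial>Q \<partial>N) = (\<integral>\<^sup>+s. \<integral>\<^sup>+z. ennreal (\<phi> (h (s, z) / c s)) \<partial>N \<partial>Q)"
      by (rule QN.Fubini') measurable
    also have "\<dots> \<le> (\<integral>\<^sup>+s. ennreal K \<partial>Q)"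
    proof (rule nn_integral_mono_AE)
      show "AE s in Q. (\<integral>\<^sup>+z. ennreal (\<phi> (h (s, z) / c s)) \<partial>N) \<le> ennreal K"
        using AEQ[OF le] by (simp add: normalized_moment_def c_def)
    qed
    also have "\<dots> = ennreal K" by (simp add: Q.emeasure_space_1)
    finally show ?thesis .
  qed
  \<comment> \<open>Jensen needs \<phi> of the ratio to be Q-integrable; the finite double integral
    supplies this for almost every z.\<close>
  have "AE z in N. (\<integral>\<^sup>+s. ennreal (\<phi> (h (s, z) / c s)) \<partial>Q) \<noteq> \<infinity>"
    using swap by (intro nn_integral_PInf_AE) (auto simp: top_unique)
  then have jensen: "AE z in N. ennreal (\<phi> (G z / cb)) \<le> (\<integral>\<^sup>+s. ennreal (\<phi> (h (s, z) / c s)) \<partial>Q)"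
    using PN.AE_integrable_snd[of "\<lambda>s z. h (s, z)", simplified, OF hi] AE_space
  proof eventually_elim
    case (elim z)
    note [measurable] = elim(3)
    have cposQ: "AE s in Q. 0 < c s" by (rule AEQ[OF cpos])
    have ih: "integrable P (\<lambda>s. (c s / cb) *\<^sub>R (h (s, z) / c s)) \<longleftrightarrow> integrable P (\<lambda>s. h (s, z) / cb)"
      using cpos by (intro integrable_cong_AE) (auto elim!: eventually_mono)
    have iQ: "integrable Q (\<lambda>s. h (s, z) / c s)"
      unfolding Q_def using cb cpos elim(2) ih
      by (subst integrable_density) (auto elim!: eventually_mono)
    have EQ: "(\<integral>s. h (s, z) / c s \<partial>Q) = G z / cb"
    proof -
      have "(\<integral>s. h (s, z) / c s \<partial>Q) = (\<integral>s. (c s / cb) *\<^sub>R (h (s, z) / c s) \<partial>P)"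
        unfolding Q_def using cb cpos by (subst integral_density) (auto elim!: eventually_mono)
      also have "\<dots> = (\<integral>s. h (s, z) / cb \<partial>P)"
        using cpos by (intro integral_cong_AE) (auto elim!: eventually_mono)
      also have "\<dots> = G z / cb" unfolding G_def by simp
      finally show ?thesis .
    qed
    have posQ: "AE s in Q. h (s, z) / c s \<in> {0<..}"
      using cposQ by eventually_elim (simp add: pos)
    have nnQ: "AE s in Q. 0 \<le> \<phi> (h (s, z) / c s)"
      using posQ by eventually_elim (simp add: nonneg)
    have i\<phi>: "integrable Q (\<lambda>s. \<phi> (h (s, z) / c s))"
      using elim(1) nnQ by (intro integrableI_nonneg) (auto simp: top.not_eq_extremum)
    have "\<phi> (G z / cb) \<le> (\<integral>s. \<phi> (h (s, z) / c s) \<partial>Q)"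
      using Q.jensens_inequality[OF iQ posQ _ i\<phi> convex] by (auto simp: EQ)
    then have "ennreal (\<phi> (G z / cb)) \<le> ennreal (\<integral>s. \<phi> (h (s, z) / c s) \<partial>Q)"
      by (rule ennreal_leI)
    also have "\<dots> = (\<integral>\<^sup>+s. ennreal (\<phi> (h (s, z) / c s)) \<partial>Q)"
      using i\<phi> nnQ by (intro nn_integral_eq_integral[symmetric]) auto
    finally show ?case .
  qed
  have "normalized_moment \<phi> N G \<le> (\<integral>\<^sup>+z. \<integral>\<^sup>+s. ennreal (\<phi> (h (s, z) / c s)) \<partial>Q \<partial>N)"
    unfolding normalized_moment_def GE using jensen by (rule nn_integral_mono_AE)
  with swap show ?thesis unfolding G_def by (rule order_trans[rotated])
qed

subsection \<open>Covering arguments for uniform measures\<close>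

lemma uniform_measure_eq_density:
  assumes "A \<in> sets M" "0 < measure M A"
  shows "uniform_measure M A = density M (\<lambda>x. ennreal (indicator A x / measure M A))"
proof -
  \<comment> \<open>A positive \<open>measure\<close> already excludes infinite mass, which
    \<open>measure\<close> sends to 0.\<close>
  have "emeasure M A = ennreal (measure M A)"
    using assms(2) by (intro emeasure_eq_ennreal_measure) (auto simp: measure_def)
  then have "indicator A x / emeasure M A = ennreal (indicator A x / measure M A)" for x
    using assms(2) by (simp add: divide_ennreal[symmetric] ennreal_indicator)
  then show ?thesis by (simp add: uniform_measure_def)
qed

lemma integrable_uniform_measure_iff:
  fixes f :: "'a \<Rightarrow> real"
  assumes "A \<in> sets M" "0 < measure M A" "f \<in> borel_measurable M"
  shows "integrable (uniform_measure M A) f \<longleftrightarrow> set_integrable M A f"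
  using assms
  by (simp add: uniform_measure_eq_density integrable_density set_integrable_def divide_inverse mult.assoc mult.commute[of _ "inverse _"] mult.left_commute[of _ "inverse _"])

lemma integral_uniform_measure:
  fixes f :: "'a \<Rightarrow> real"
  assumes "A \<in> sets M" "0 < measure M A" "f \<in> borel_measurable M"
  shows "(\<integral>x. f x \<partial>uniform_measure M A) = set_lebesgue_integral M A f / measure M A"
  using assms
  by (simp add: uniform_measure_eq_density integral_density set_lebesgue_integral_def)

lemma nn_integral_indicator_eq_uniform_measure:
  assumes "A \<in> sets M" "0 < measure M A" "f \<in> borel_measurable M"
  shows "(\<integral>\<^sup>+x. f x * indicator A x \<partial>M) = ennreal (measure M A) * (\<integral>\<^sup>+x. f x \<partial>uniform_measure M A)"
proof -
  have "(\<integral>\<^sup>+x. f x \<partial>uniform_measure M A) = (\<integral>\<^sup>+x. ennreal (1 / measure M A) * (f x * indicator A x) \<partial>M)"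
    unfolding uniform_measure_eq_density[OF assms(1,2)] using assms
    by (subst nn_integral_density) (auto intro!: nn_integral_cong simp: indicator_def)
  also have "\<dots> = ennreal (1 / measure M A) * (\<integral>\<^sup>+x. f x * indicator A x \<partial>M)"
    using assms by (intro nn_integral_cmult) auto
  finally have eq: "(\<integral>\<^sup>+x. f x \<partial>uniform_measure M A) = ennreal (1 / measure M A) * (\<integral>\<^sup>+x. f x * indicator A x \<partial>M)" .
  have "ennreal (measure M A) * ennreal (1 / measure M A) = 1"
    using assms(2) by (simp add: ennreal_mult[symmetric])
  then show ?thesis unfolding eq by (simp add: mult.assoc[symmetric])
qed

lemma prob_space_uniform_measure_pos:
  assumes "0 < measure M A"
  shows "prob_space (uniform_measure M A)"
proof (rule prob_space_uniform_measure)
  show "emeasure M A \<noteq> 0" "emeasure M A \<noteq> \<infinity>"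
    using assms by (auto simp: measure_def)
qed

text \<open>On a piece with mean e put x = g / e. Then g / c = (e / c) x, and \<open>dilate\<close>
  bounds \<psi> (g / c) by A \<phi> x + B (x + 1), whose mean is at most A K + 2 B since x has mean
  1. Summing over the pieces with their measures as weights gives the factor n.\<close>

lemma normalized_moment_cover:
  fixes g :: "'a \<Rightarrow> real"
  assumes g[measurable]: "g \<in> borel_measurable N" and pos: "\<And>z. 0 < g z"
    and R[measurable]: "R \<in> sets N" "0 < measure N R" "set_integrable N R g"
    and J: "finite J"
    and D[measurable]: "\<And>i. i \<in> J \<Longrightarrow> D i \<in> sets N"
    and D': "\<And>i. i \<in> J \<Longrightarrow> 0 < measure N (D i)" "\<And>i. i \<in> J \<Longrightarrow> set_integrable N (D i) g"
    and cover: "R \<subseteq> (\<Union>i\<in>J. D i)"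
    and total: "(\<Sum>i\<in>J. measure N (D i)) \<le> n * measure N R"
    and \<phi>[measurable]: "\<phi> \<in> borel_measurable borel" "\<psi> \<in> borel_measurable borel"
    and nonneg: "\<And>x. 0 < x \<Longrightarrow> 0 \<le> \<phi> x"
    and AB: "0 \<le> A" "0 \<le> B" "0 \<le> K"
    and moment: "\<And>i. i \<in> J \<Longrightarrow> normalized_moment \<phi> (uniform_measure N (D i)) g \<le> ennreal K"
    and dilate: "\<And>i x. i \<in> J \<Longrightarrow> 0 < x \<Longrightarrow>
      \<psi> ((\<integral>x. g x \<partial>uniform_measure N (D i)) / (\<integral>x. g x \<partial>uniform_measure N R) * x) \<le> A * \<phi> x + B * (x + 1)"
  shows "normalized_moment \<psi> (uniform_measure N R) g \<le> ennreal (n * (A * K + 2 * B))"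
proof -
  define c where "c = (\<integral>x. g x \<partial>uniform_measure N R)"
  let ?L = "A * K + 2 * B"
  have L: "0 \<le> ?L" using AB by simp
  have piece: "(\<integral>\<^sup>+z. ennreal (\<psi> (g z / c)) \<partial>uniform_measure N (D i)) \<le> ennreal ?L" if i: "i \<in> J" for i
  proof -
    note [measurable] = D[OF i]
    interpret U: prob_space "uniform_measure N (D i)" by (rule prob_space_uniform_measure_pos[OF D'(1)[OF i]])
    let ?e = "\<integral>x. g x \<partial>uniform_measure N (D i)"
    have gi: "integrable (uniform_measure N (D i)) g"
      using D'(1,2)[OF i] by (simp add: integrable_uniform_measure_iff D[OF i])
    have e: "0 < ?e" using gi by (rule U.expectation_greater) (simp add: pos)
    have "(\<integral>\<^sup>+z. ennreal (\<psi> (g z / c)) \<partial>uniform_measure N (D i))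
        \<le> (\<integral>\<^sup>+z. ennreal A * ennreal (\<phi> (g z / ?e)) + ennreal (B * (g z / ?e + 1)) \<partial>uniform_measure N (D i))"
    proof (rule nn_integral_mono)
      fix z
      have p: "0 < g z / ?e" using e pos by simp
      have "\<psi> (g z / c) \<le> A * \<phi> (g z / ?e) + B * (g z / ?e + 1)"
        using dilate[OF i p] e by (simp add: c_def)
      then show "ennreal (\<psi> (g z / c)) \<le> ennreal A * ennreal (\<phi> (g z / ?e)) + ennreal (B * (g z / ?e + 1))"
        using AB p nonneg[OF p] mult_nonneg_nonneg[of B "g z / ?e + 1"]
        by (simp add: ennreal_mult[symmetric] ennreal_plus[symmetric] ennreal_leI del: ennreal_plus)
    qed
    also have "\<dots> = ennreal A * normalized_moment \<phi> (uniform_measure N (D i)) g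
        + (\<integral>\<^sup>+z. ennreal (B * (g z / ?e + 1)) \<partial>uniform_measure N (D i))"
      unfolding normalized_moment_def by (subst nn_integral_add) (auto simp: nn_integral_cmult)
    also have "(\<integral>\<^sup>+z. ennreal (B * (g z / ?e + 1)) \<partial>uniform_measure N (D i))
        = ennreal (\<integral>z. B * (g z / ?e + 1) \<partial>uniform_measure N (D i))"
      using gi AB pos e by (intro nn_integral_eq_integral) (auto intro!: mult_nonneg_nonneg add_nonneg_nonneg simp: less_imp_le)
    also have "(\<integral>z. B * (g z / ?e + 1) \<partial>uniform_measure N (D i)) = 2 * B"
      using gi e U.prob_space by simp
    also have "ennreal A * normalized_moment \<phi> (uniform_measure N (D i)) g + ennreal (2 * B) \<le> ennreal A * ennreal K + ennreal (2 * B)"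
      by (intro add_right_mono mult_left_mono moment i) simp
    also have "\<dots> = ennreal ?L" using AB by (simp add: ennreal_mult)
    finally show ?thesis .
  qed
  have "ennreal (measure N R) * normalized_moment \<psi> (uniform_measure N R) g = (\<integral>\<^sup>+z. ennreal (\<psi> (g z / c)) * indicator R z \<partial>N)"
    unfolding normalized_moment_def c_def[symmetric]
    by (rule nn_integral_indicator_eq_uniform_measure[symmetric]) (use R in auto)
  also have "\<dots> \<le> (\<integral>\<^sup>+z. (\<Sum>i\<in>J. ennreal (\<psi> (g z / c)) * indicator (D i) z) \<partial>N)"
  proof (rule nn_integral_mono)
    fix z
    have "indicator R z \<le> (\<Sum>i\<in>J. indicator (D i) z :: ennreal)"
    proof (cases "z \<in> R")
      case True
      then obtain i where "i \<in> J" "z \<in> D i" using cover by auto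
      then have "indicator R z \<le> (indicator (D i) z :: ennreal)" by (simp add: True)
      also have "\<dots> \<le> (\<Sum>i\<in>J. indicator (D i) z)"
        using \<open>i \<in> J\<close> J by (intro member_le_sum) auto
      finally show ?thesis .
    qed simp
    then show "ennreal (\<psi> (g z / c)) * indicator R z \<le> (\<Sum>i\<in>J. ennreal (\<psi> (g z / c)) * indicator (D i) z)"
      unfolding sum_distrib_left[symmetric] by (rule mult_left_mono) simp
  qed
  also have "\<dots> = (\<Sum>i\<in>J. \<integral>\<^sup>+z. ennreal (\<psi> (g z / c)) * indicator (D i) z \<partial>N)"
    by (rule nn_integral_sum) auto
  also have "\<dots> = (\<Sum>i\<in>J. ennreal (measure N (D i)) * (\<integral>\<^sup>+z. ennreal (\<psi> (g z / c)) \<partial>uniform_measure N (D i)))"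
    by (intro sum.cong refl nn_integral_indicator_eq_uniform_measure) (use D' D in auto)
  also have "\<dots> \<le> (\<Sum>i\<in>J. ennreal (measure N (D i)) * ennreal ?L)"
    by (intro sum_mono mult_left_mono piece) auto
  also have "\<dots> = ennreal ((\<Sum>i\<in>J. measure N (D i)) * ?L)"
    using L by (simp add: sum_distrib_right ennreal_mult[symmetric])
  also have "\<dots> \<le> ennreal (measure N R * (n * ?L))"
    using mult_right_mono[OF total L] by (intro ennreal_leI) (simp add: ac_simps)
  finally have *: "ennreal (measure N R) * normalized_moment \<psi> (uniform_measure N R) g \<le> ennreal (measure N R * (n * ?L))" .
  have "ennreal (1 / measure N R) * (ennreal (measure N R) * normalized_moment \<psi> (uniform_measure N R) g)
      \<le> ennreal (1 / measure N R) * ennreal (measure N R * (n * ?L))"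
    by (rule mult_left_mono[OF *]) simp
  then show ?thesis
    using R(2) by (simp add: mult.assoc[symmetric] ennreal_mult'[symmetric])
qed

subsection \<open>Doubling weights and dyadic rectangles\<close>

lemma set_lebesgue_integral_lebesgue_eq_lborel:
  fixes g :: "'a::euclidean_space \<Rightarrow> real"
  assumes "g \<in> borel_measurable borel" "S \<in> sets borel"
  shows "set_lebesgue_integral lebesgue S g = set_lebesgue_integral lborel S g"
  unfolding set_lebesgue_integral_def by (rule integral_completion) (use assms in simp)

text \<open>Integer indices, because a torus rectangle is represented by real intervals that may
  leave [0,1).\<close>

definition dyadz :: "nat \<Rightarrow> int \<Rightarrow> real set" where
  "dyadz k i = {real_of_int i / 2^k ..< (real_of_int i + 1) / 2^k}"

text \<open>Centre and radii, so that one use of \<open>doubling\<close> just doubles both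
  radii.\<close>

definition cbox2 :: "real \<Rightarrow> real \<Rightarrow> real \<Rightarrow> real \<Rightarrow> (real \<times> real) set" where
  "cbox2 x y r s = {x - r..x + r} \<times> {y - s..y + s}"

lemma borel_cbox2[measurable]: "cbox2 x y r s \<in> sets borel"
  unfolding cbox2_def by (intro borel_Times) auto

lemma borel_dyadz_Times[measurable]: "dyadz k i \<times> dyadz k' j \<in> sets borel"
  unfolding dyadz_def by (intro borel_Times) auto

lemma measure_lborel_Times:
  fixes A B :: "real set"
  assumes "A \<in> sets borel" "B \<in> sets borel"
  shows "measure lborel (A \<times> B) = measure lborel A * measure lborel B"
proof -
  have "emeasure lborel (A \<times> B) = emeasure lborel A * emeasure lborel B"
    using assms lborel.emeasure_pair_measure_Times[of A lborel B] by (simp add: lborel_prod)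
  then show ?thesis by (simp add: measure_def enn2real_mult)
qed

lemma measure_cbox2: "0 < r \<Longrightarrow> 0 < s \<Longrightarrow> measure lborel (cbox2 x y r s) = (2 * r) * (2 * s)"
  unfolding cbox2_def by (subst measure_lborel_Times) auto

lemma measure_dyadz_Times: "measure lborel (dyadz k i \<times> dyadz k' j) = (1 / 2^k) * (1 / 2^k')"
proof -
  have "measure lborel (dyadz k i) = 1 / 2^k" for k i
    unfolding dyadz_def by (simp add: divide_simps)
  then show ?thesis by (subst measure_lborel_Times) (auto simp: dyadz_def)
qed

section \<open>Dyadic intervals of comparable length meeting a given interval\<close>

lemma dyadic_scale_exists:
  assumes "0 < l" "l \<le> (1::real)"
  shows "\<exists>k. l / 16 < 1 / 2^k \<and> 1 / 2^k \<le> l / 8"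
proof -
  have ex: "\<exists>k. 8 / l \<le> 2^k" using real_arch_pow[of 2 "8 / l"] by (auto intro: less_imp_le)
  define k where "k = (LEAST k. 8 / l \<le> (2::real)^k)"
  have k: "8 / l \<le> 2^k" unfolding k_def using ex by (rule LeastI_ex)
  \<comment> \<open>Here l \<le> 1 enters: 8 / l is at least 8 while 2^0 = 1, so k has a
    predecessor. There the inequality fails, which gives the other bound 2^k < 16 / l.\<close>
  have "k \<noteq> 0"
  proof
    assume "k = 0"
    then show False using k assms by (simp add: divide_simps)
  qed
  then obtain k' where k': "k = Suc k'" using not0_implies_Suc by blast
  have "\<not> 8 / l \<le> 2^k'" using k' unfolding k_def by (intro not_less_Least) auto
  then have "2^k < 16 / l" using k' by simp
  then show ?thesis using k assms by (intro exI[of _ k]) (auto simp: field_simps)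
qed

text \<open>The length d = 1 / 2^k lies in (r/8, r/4] and c is the midpoint. The dyadic interval
  stays within r + d < 2 r of x. Its half-length d / 2 exceeds r / 16 strictly, so the missing right
  endpoint does no harm. Finally |c - x| \<le> r + d / 2 \<le> 9 r / 8, so radius 2 r about c covers
  radius r / 2 about x.\<close>

lemma dyadz_meeting_interval:
  assumes r: "0 < r" and k: "r / 8 < 1 / 2^k" "1 / 2^k \<le> r / 4"
    and y: "y \<in> {x - r..x + r}"
  defines "i \<equiv> \<lfloor>y * 2^k\<rfloor>"
  defines "c \<equiv> (real_of_int i + 1/2) / 2^k"
  shows "y \<in> dyadz k i" "dyadz k i \<subseteq> {x - 2*r..x + 2*r}"
    "{c - r/16..c + r/16} \<subseteq> dyadz k i" "{x - r/2..x + r/2} \<subseteq> {c - 2*r..c + 2*r}"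
proof -
  define d where "d = 1 / (2::real)^k"
  have d: "0 < d" "r / 8 < d" "d \<le> r / 4" using k by (auto simp: d_def)
  have dy: "dyadz k i = {real_of_int i * d ..< (real_of_int i + 1) * d}" by (simp add: dyadz_def d_def)
  have c: "c = (real_of_int i + 1/2) * d" by (simp add: c_def d_def)
  have yd: "y = (y * 2^k) * d" by (simp add: d_def)
  have "real_of_int i \<le> y * 2^k" "y * 2^k < real_of_int i + 1" unfolding i_def by linarith+
  then have id: "real_of_int i * d \<le> y" "y < (real_of_int i + 1) * d"
    using d(1) yd by (metis mult_right_mono less_imp_le, metis mult_strict_right_mono)
  then show "y \<in> dyadz k i" by (simp add: dy)
  have y': "x - r \<le> y" "y \<le> x + r" using y by auto
  have e: "(real_of_int i + 1) * d = real_of_int i * d + d" "c = real_of_int i * d + d / 2"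
    by (simp_all add: c algebra_simps)
  show "dyadz k i \<subseteq> {x - 2*r..x + 2*r}"
    unfolding dy using id y' d r e by auto
  show "{c - r/16..c + r/16} \<subseteq> dyadz k i"
    unfolding dy using d r e by auto
  show "{x - r/2..x + r/2} \<subseteq> {c - 2*r..c + 2*r}"
    using id y' d r e by auto
qed

text \<open>Scaled by 2^k < 8 / r, an interval of length 2 r has length at most 16, so the floors
  lie among 17 consecutive integers.\<close>

lemma card_dyadz_meeting_interval:
  fixes r x :: real
  assumes r: "0 < r" and k: "r / 8 < 1 / 2^k"
  shows "finite ((\<lambda>y. \<lfloor>y * 2^k\<rfloor>) ` {x - r..x + r})" (is "finite ?T")
    and "card ((\<lambda>y. \<lfloor>y * 2^k\<rfloor>) ` {x - r..x + r}) \<le> 17"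
proof -
  let ?a = "\<lfloor>(x - r) * 2^k\<rfloor>"
  have sub: "?T \<subseteq> {?a..?a + 16}"
  proof (rule image_subsetI)
    fix y assume y: "y \<in> {x - r..x + r}"
    have "(x - r) * 2^k \<le> y * 2^k" using y by auto
    moreover have "y * 2^k \<le> (x - r) * 2^k + 16"
    proof -
      have "y * 2^k \<le> (x + r) * 2^k" using y by auto
      also have "\<dots> = (x - r) * 2^k + 2 * (r * 2^k)" by (simp add: algebra_simps)
      also have "r * 2^k \<le> 8" using k by (simp add: field_simps)
      finally show ?thesis by simp
    qed
    ultimately show "\<lfloor>y * 2^k\<rfloor> \<in> {?a..?a + 16}" by (auto intro: floor_mono) linarith
  qed
  then show "finite ?T" by (rule finite_subset) simp
  have "card ?T \<le> card {?a..?a + 16}" by (rule card_mono[OF _ sub]) simp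
  then show "card ?T \<le> 17" by simp
qed

lemma set_integral_mono_set_pos:
  fixes g :: "'a::euclidean_space \<Rightarrow> real"
  assumes "set_integrable lborel T g" "S \<subseteq> T" "S \<in> sets borel" "\<And>z. 0 < g z"
  shows "set_lebesgue_integral lborel S g \<le> set_lebesgue_integral lborel T g"
  unfolding set_lebesgue_integral_def
proof (rule integral_mono)
  show "integrable lborel (\<lambda>x. indicat_real T x *\<^sub>R g x)" using assms(1) by (simp add: set_integrable_def)
  show "integrable lborel (\<lambda>x. indicat_real S x *\<^sub>R g x)"
    using set_integrable_subset[OF assms(1), of S] assms(2,3) by (simp add: set_integrable_def)
  show "indicat_real S z *\<^sub>R g z \<le> indicat_real T z *\<^sub>R g z" for z
    using assms(2) assms(4)[of z] by (auto simp: indicator_def)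
qed

text \<open>The last of n doublings starts from radius \<open>2^(n-1) * r\<close>, that is from a
  side \<open>2^n * r\<close>; this is the quantity that \<open>doubling\<close> wants to be at most
  1.\<close>

lemma doubling_cbox2_power:
  fixes g :: "real \<times> real \<Rightarrow> real"
  assumes g: "g \<in> borel_measurable borel" and dbl: "doubling C g" and C: "0 \<le> C"
    and "0 < r" "2^n * r \<le> 1" "0 < s" "2^n * s \<le> 1"
  shows "set_lebesgue_integral lborel (cbox2 x y (2^n * r) (2^n * s)) g
    \<le> C^n * set_lebesgue_integral lborel (cbox2 x y r s) g"
  using assms(5,7)
proof (induction n)
  case (Suc n)
  let ?r = "2^n * r" and ?s = "2^n * s"
  have rs: "0 < ?r" "0 < ?s" using assms by auto
  have b: "2 * ?r \<le> 1" "2 * ?s \<le> 1" using Suc.prems by simp_all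
  have "set_lebesgue_integral lebesgue ({x - ?r - 2*?r/2 .. x - ?r + 3*(2*?r)/2} \<times> {y - ?s - 2*?s/2 .. y - ?s + 3*(2*?s)/2}) g
     \<le> C * set_lebesgue_integral lebesgue ({x - ?r..x - ?r + 2*?r} \<times> {y - ?s..y - ?s + 2*?s}) g"
    using dbl rs b unfolding doubling_def by (metis mult_pos_pos zero_less_numeral)
  also have "{x - ?r - 2*?r/2 .. x - ?r + 3*(2*?r)/2} \<times> {y - ?s - 2*?s/2 .. y - ?s + 3*(2*?s)/2} = cbox2 x y (2 * ?r) (2 * ?s)"
    by (simp add: cbox2_def algebra_simps)
  also have "{x - ?r..x - ?r + 2*?r} \<times> {y - ?s..y - ?s + 2*?s} = cbox2 x y ?r ?s"
    by (simp add: cbox2_def algebra_simps)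
  finally have 1: "set_lebesgue_integral lborel (cbox2 x y (2 * ?r) (2 * ?s)) g \<le> C * set_lebesgue_integral lborel (cbox2 x y ?r ?s) g"
    by (simp add: set_lebesgue_integral_lebesgue_eq_lborel g)
  have "?r \<le> 1" "?s \<le> 1" using b rs by linarith+
  then have "set_lebesgue_integral lborel (cbox2 x y ?r ?s) g \<le> C^n * set_lebesgue_integral lborel (cbox2 x y r s) g"
    by (rule Suc.IH)
  then have "C * set_lebesgue_integral lborel (cbox2 x y ?r ?s) g \<le> C * (C^n * set_lebesgue_integral lborel (cbox2 x y r s) g)"
    using C by (rule mult_left_mono)
  with 1 show ?case by (simp add: mult.assoc)
qed simp

text \<open>The dyadic rectangles used have sides between 1/16 and 1/8 of those of the given rectangle, so
that one doubling of the latter contains them; conversely five doublings of a concentric subrectangle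
of such a dyadic one contain the concentric half of the given rectangle. No doubling is ever applied to a
side longer than 1.\<close>

lemma normalized_moment_doubling:
  fixes g :: "real \<times> real \<Rightarrow> real"
  assumes g[measurable]: "g \<in> borel_measurable borel" and pos: "\<And>z. 0 < g z"
    and loc: "\<And>a b c d. set_integrable lborel ({a..b} \<times> {c..d}) g"
    and dbl: "doubling C g"
    and \<phi>: "\<phi> \<in> borel_measurable borel" "\<psi> \<in> borel_measurable borel"
    and nonneg: "\<And>x. 0 < x \<Longrightarrow> 0 \<le> \<phi> x"
    and AB: "0 \<le> A" "0 \<le> B" "0 \<le> K"
    and moment: "\<And>k1 i k2 j. normalized_moment \<phi> (uniform_measure lborel (dyadz k1 i \<times> dyadz k2 j)) g \<le> ennreal K"
    and M: "M = 256 * max C 1 ^ 6"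
    and dilate: "\<And>q x. 1 / M \<le> q \<Longrightarrow> q \<le> M \<Longrightarrow> 0 < x \<Longrightarrow> \<psi> (q * x) \<le> A * \<phi> x + B * (x + 1)"
    and R: "R \<in> torus_rects"
  shows "normalized_moment \<psi> (uniform_measure lborel R) g \<le> ennreal (5 * (A * K + 2 * B))"
proof -
  let ?I = "\<lambda>S. set_lebesgue_integral lborel S g"
  have locb: "set_integrable lborel (cbox2 x y r s) g" for x y r s
    unfolding cbox2_def by (rule loc)
  obtain a l b m where lm: "0 < l" "l \<le> 1" "0 < m" "m \<le> 1" and Rab: "R = {a..a+l} \<times> {b..b+m}"
    using R unfolding torus_rects_def by blast
  define r s x y where "r = l / 2" and "s = m / 2" and "x = a + l / 2" and "y = b + m / 2"
  have rs: "0 < r" "r \<le> 1/2" "0 < s" "s \<le> 1/2" using lm by (auto simp: r_def s_def)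
  have Rxy: "R = cbox2 x y r s" unfolding Rab cbox2_def x_def y_def r_def s_def by (simp add: algebra_simps)
  obtain k1 where k1: "r / 8 < 1 / 2^k1" "1 / 2^k1 \<le> r / 4"
    using dyadic_scale_exists[of l] lm by (auto simp: r_def)
  obtain k2 where k2: "s / 8 < 1 / 2^k2" "1 / 2^k2 \<le> s / 4"
    using dyadic_scale_exists[of m] lm by (auto simp: s_def)
  define T1 where "T1 = (\<lambda>y. \<lfloor>y * 2^k1\<rfloor>) ` {x - r..x + r}"
  define T2 where "T2 = (\<lambda>y. \<lfloor>y * 2^k2\<rfloor>) ` {y - s..y + s}"
  define D where "D = (\<lambda>(i, j). dyadz k1 i \<times> dyadz k2 j)"
  have DS[measurable]: "D ij \<in> sets borel" for ij unfolding D_def by (cases ij) simp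
  have T1: "finite T1" "card T1 \<le> 17" and T2: "finite T2" "card T2 \<le> 17"
    unfolding T1_def T2_def using card_dyadz_meeting_interval rs k1 k2 by auto
  have mR: "measure lborel R = 4 * (r * s)" using rs by (simp add: Rxy measure_cbox2)
  then have mRpos: "0 < measure lborel R" using rs by simp
  define d where "d = 1 / 2^k1 * (1 / (2::real)^k2)"
  have mD: "measure lborel (D ij) = d" for ij unfolding D_def d_def by (cases ij) (simp add: measure_dyadz_Times)
  have dpos: "0 < d" by (simp add: d_def)
  \<comment> \<open>R has area 4 r s, while d lies between r s / 64 and r s / 16: hence the factors
    64 and 256.\<close>
  have dle: "64 * d \<le> measure lborel R"
  proof -
    have "d \<le> (r / 4) * (s / 4)" unfolding d_def using k1 k2 rs by (intro mult_mono) auto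
    then show ?thesis by (simp add: mR)
  qed
  have dge: "measure lborel R \<le> 256 * d"
  proof -
    have "(r / 8) * (s / 8) \<le> d" unfolding d_def using k1 k2 rs by (intro mult_mono) auto
    then show ?thesis by (simp add: mR)
  qed
  \<comment> \<open>At least 1, so that its powers increase; \<open>doubling\<close> survives the
    enlargement because the integrals are nonnegative.\<close>
  define C' where "C' = max C 1"
  have C': "1 \<le> C'" by (simp add: C'_def)
  have dbl': "doubling C' g"
    unfolding doubling_def
  proof (intro allI impI)
    fix a b l m :: real assume lm: "0 < l \<and> l \<le> 1 \<and> 0 < m \<and> m \<le> 1"
    have "0 \<le> set_lebesgue_integral lebesgue ({a..a + l} \<times> {b..b + m}) g"
      unfolding set_lebesgue_integral_def using pos by (intro Bochner_Integration.integral_nonneg) (auto simp: less_imp_le)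
    then have "C * set_lebesgue_integral lebesgue ({a..a + l} \<times> {b..b + m}) g \<le> C' * set_lebesgue_integral lebesgue ({a..a + l} \<times> {b..b + m}) g"
      by (intro mult_right_mono) (auto simp: C'_def)
    then show "set_lebesgue_integral lebesgue ({a - l/2 .. a + 3*l/2} \<times> {b - m/2 .. b + 3*m/2}) g
       \<le> C' * set_lebesgue_integral lebesgue ({a..a+l} \<times> {b..b+m}) g"
      using dbl lm unfolding doubling_def by (meson order_trans)
  qed
  have geom: "D ij \<subseteq> cbox2 x y (2 * r) (2 * s) \<and> (\<exists>u v. cbox2 u v (r / 16) (s / 16) \<subseteq> D ij \<and>
      cbox2 x y (r / 2) (s / 2) \<subseteq> cbox2 u v (2 * r) (2 * s))" if ij: "ij \<in> T1 \<times> T2" for ij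
  proof -
    obtain y1 y2 where y1: "y1 \<in> {x - r..x + r}" and y2: "y2 \<in> {y - s..y + s}"
      and eq: "ij = (\<lfloor>y1 * 2^k1\<rfloor>, \<lfloor>y2 * 2^k2\<rfloor>)"
      using ij unfolding T1_def T2_def by auto
    note 1 = dyadz_meeting_interval[OF rs(1) k1 y1] and 2 = dyadz_meeting_interval[OF rs(3) k2 y2]
    show ?thesis
      unfolding eq D_def cbox2_def prod.case
      using Sigma_mono[OF 1(2) 2(2)] Sigma_mono[OF 1(3) 2(3)] Sigma_mono[OF 1(4) 2(4)] by blast
  qed
  have DR: "?I (D ij) \<le> C' * ?I R" if ij: "ij \<in> T1 \<times> T2" for ij
  proof -
    have "?I (D ij) \<le> ?I (cbox2 x y (2^1 * r) (2^1 * s))"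
      using geom[OF ij] by (intro set_integral_mono_set_pos locb pos DS) simp
    also have "\<dots> \<le> C'^1 * ?I (cbox2 x y r s)"
      using rs C' by (intro doubling_cbox2_power[OF g dbl']) auto
    finally show ?thesis by (simp add: Rxy)
  qed
  have Dint: "set_integrable lborel (D ij) g" if ij: "ij \<in> T1 \<times> T2" for ij
    using set_integrable_subset[OF locb, of "D ij"] geom[OF ij] DS by auto
  \<comment> \<open>One doubling shrinks R to half its radii; five more lead from radius r / 16
    inside the dyadic rectangle to 2 r. Enclosing R itself about that centre could require more than
    2 r, and then the last doubled side could exceed 1.\<close>
  have RD: "?I R \<le> C'^6 * ?I (D ij)" if ij: "ij \<in> T1 \<times> T2" for ij
  proof -
    obtain u v where uv: "cbox2 u v (r / 16) (s / 16) \<subseteq> D ij"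
      "cbox2 x y (r / 2) (s / 2) \<subseteq> cbox2 u v (2 * r) (2 * s)" using geom[OF ij] by blast
    have "?I R = ?I (cbox2 x y (2^1 * (r/2)) (2^1 * (s/2)))" by (simp add: Rxy)
    also have "\<dots> \<le> C'^1 * ?I (cbox2 x y (r/2) (s/2))"
      using rs C' by (intro doubling_cbox2_power[OF g dbl']) auto
    also have "?I (cbox2 x y (r/2) (s/2)) \<le> ?I (cbox2 u v (2^5 * (r/16)) (2^5 * (s/16)))"
      using uv by (intro set_integral_mono_set_pos locb pos) auto
    also have "?I (cbox2 u v (2^5 * (r/16)) (2^5 * (s/16))) \<le> C'^5 * ?I (cbox2 u v (r/16) (s/16))"
      using rs C' by (intro doubling_cbox2_power[OF g dbl']) auto
    also have "?I (cbox2 u v (r/16) (s/16)) \<le> ?I (D ij)"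
      using uv by (intro set_integral_mono_set_pos Dint ij pos) auto
    finally show ?thesis using C' by (simp add: mult_left_mono power_Suc[symmetric] mult.assoc[symmetric])
  qed
  have RS[measurable]: "R \<in> sets borel" unfolding Rxy by simp
  interpret UR: prob_space "uniform_measure lborel R" by (rule prob_space_uniform_measure_pos[OF mRpos])
  have IR: "0 < ?I R / measure lborel R"
  proof -
    have "0 < (\<integral>z. g z \<partial>uniform_measure lborel R)"
      using mRpos locb[of x y r s] by (intro UR.expectation_greater) (auto simp: pos integrable_uniform_measure_iff Rxy)
    then show ?thesis using mRpos by (simp add: integral_uniform_measure)
  qed
  then have IR': "0 < ?I R" using mRpos by (simp add: zero_less_divide_iff)
  show ?thesis
  proof (rule normalized_moment_cover[where J = "T1 \<times> T2" and D = D and \<phi> = \<phi>])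
    show "R \<subseteq> (\<Union>i\<in>T1 \<times> T2. D i)"
    proof
      fix z assume "z \<in> R"
      then obtain z1 z2 where z: "z = (z1, z2)" "z1 \<in> {x - r..x + r}" "z2 \<in> {y - s..y + s}"
        unfolding Rxy cbox2_def by blast
      have "z \<in> D (\<lfloor>z1 * 2^k1\<rfloor>, \<lfloor>z2 * 2^k2\<rfloor>)"
        unfolding D_def using dyadz_meeting_interval(1)[OF rs(1) k1 z(2)] dyadz_meeting_interval(1)[OF rs(3) k2 z(3)] z
        by simp
      then show "z \<in> (\<Union>i\<in>T1 \<times> T2. D i)" using z unfolding T1_def T2_def by blast
    qed
    \<comment> \<open>There are at most 17 * 17 = 289 pieces, each with at most a 64th of the area
      of R, and 289 / 64 < 5.\<close>
    have "card (T1 \<times> T2) \<le> 17 * 17" using T1 T2 unfolding card_cartesian_product by (intro mult_mono) auto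
    then have "real (card (T1 \<times> T2)) * d \<le> 289 * d" using dpos by (intro mult_right_mono) linarith+
    also have "\<dots> \<le> 5 * measure lborel R" using dle dpos by simp
    finally show "(\<Sum>i\<in>T1 \<times> T2. measure lborel (D i)) \<le> 5 * measure lborel R" by (simp add: mD)
    fix ij assume ij: "ij \<in> T1 \<times> T2"
    show "normalized_moment \<phi> (uniform_measure lborel (D ij)) g \<le> ennreal K"
      unfolding D_def by (cases ij) (simp add: moment)
    fix t :: real assume t: "0 < t"
    \<comment> \<open>The ratio of means is a ratio of integrals, between 1 / C'^6 and C'^6, times a
      ratio of areas, between 1 and 256; M absorbs both.\<close>
    let ?q = "(\<integral>x. g x \<partial>uniform_measure lborel (D ij)) / (\<integral>x. g x \<partial>uniform_measure lborel R)"
    have q: "?q = (?I (D ij) / ?I R) * (measure lborel R / d)"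
      using mRpos dpos by (simp add: integral_uniform_measure mD field_simps)
    have 1: "1 / C'^6 \<le> ?I (D ij) / ?I R"
      using RD[OF ij] IR' C' by (simp add: field_simps)
    have 2: "?I (D ij) / ?I R \<le> C'^6"
    proof -
      have "?I (D ij) / ?I R \<le> C'" using DR[OF ij] IR' by (simp add: field_simps)
      also have "\<dots> \<le> C'^6" using C' power_increasing[of 1 6 C'] by simp
      finally show ?thesis .
    qed
    have 3: "1 \<le> measure lborel R / d" "measure lborel R / d \<le> 256"
      using dle dge dpos by (auto simp: field_simps)
    have "1 / M \<le> 1 / C'^6" unfolding M C'_def[symmetric] using C' by (intro divide_left_mono) auto
    also have "\<dots> \<le> (1 / C'^6) * (measure lborel R / d)" using mult_left_mono[OF 3(1), of "1 / C'^6"] C' by simp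
    also have "\<dots> \<le> ?q" unfolding q using 1 3 by (intro mult_right_mono) auto
    finally have q1: "1 / M \<le> ?q" .
    have "?q \<le> C'^6 * 256" unfolding q using 2 3 C' by (intro mult_mono) auto
    then have q2: "?q \<le> M" unfolding M C'_def[symmetric] by simp
    show "\<psi> (?q * t) \<le> A * \<phi> t + B * (t + 1)" by (rule dilate[OF q1 q2 t])
  qed (use mRpos T1 T2 DS mD dpos Dint pos \<phi> nonneg AB locb Rxy in auto)
qed

subsection \<open>Translations and periodicity\<close>

lemma uniform_measure_lborel_translation:
  fixes c :: "'a::euclidean_space"
  assumes S[measurable]: "S \<in> sets borel" "(+) c ` S \<in> sets borel"
  shows "uniform_measure lborel ((+) c ` S) = distr (uniform_measure lborel S) borel ((+) c)"
proof (rule measure_eqI)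
  have tr: "emeasure lborel X = emeasure lborel ((+) c -` X)" if [measurable]: "X \<in> sets borel" for X
  proof -
    have "emeasure lborel X = emeasure (distr lborel borel ((+) c)) X" by (simp add: lborel_distr_plus)
    also have "\<dots> = emeasure lborel ((+) c -` X)" by (subst emeasure_distr) auto
    finally show ?thesis .
  qed
  fix X assume "X \<in> sets (uniform_measure lborel ((+) c ` S))"
  then have X[measurable]: "X \<in> sets borel" by simp
  have "(+) c -` X \<inter> space borel \<in> sets borel" by (rule measurable_sets[OF _ X]) simp
  then have vX: "(+) c -` X \<in> sets borel" by simp
  have eq: "(+) c -` ((+) c ` S \<inter> X) = S \<inter> (+) c -` X" "(+) c -` ((+) c ` S) = S" by auto
  have "emeasure (uniform_measure lborel ((+) c ` S)) X = emeasure lborel (S \<inter> (+) c -` X) / emeasure lborel S"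
    using tr[of "(+) c ` S \<inter> X"] tr[of "(+) c ` S"] by (simp add: eq)
  also have "\<dots> = emeasure (distr (uniform_measure lborel S) borel ((+) c)) X"
    by (subst emeasure_distr) (auto simp: vX)
  finally show "emeasure (uniform_measure lborel ((+) c ` S)) X = emeasure (distr (uniform_measure lborel S) borel ((+) c)) X" .
qed simp

lemma normalized_moment_translation:
  fixes c :: "'a::euclidean_space"
  assumes S: "S \<in> sets borel" "(+) c ` S \<in> sets borel"
    and [measurable]: "g \<in> borel_measurable borel" "\<phi> \<in> borel_measurable borel"
  shows "normalized_moment \<phi> (uniform_measure lborel ((+) c ` S)) g
    = normalized_moment \<phi> (uniform_measure lborel S) (\<lambda>z. g (c + z))"
proof -
  have [measurable]: "(+) c \<in> uniform_measure lborel S \<rightarrow>\<^sub>M borel" by simp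
  show ?thesis
    unfolding normalized_moment_def uniform_measure_lborel_translation[OF S]
    by (subst nn_integral_distr) (simp_all add: integral_distr)
qed

text \<open>The conditions are stated for \<open>lebesgue\<close>, while products and Fubini are
  used on \<open>lborel\<close>. Completeness of \<open>lebesgue\<close> makes g measurable once it
  agrees almost everywhere with a Borel function.\<close>

lemma normalized_moment_lebesgue_eq_lborel:
  fixes g :: "'a::euclidean_space \<Rightarrow> real"
  assumes g'[measurable]: "g' \<in> borel_measurable borel" and eq: "AE z in lborel. g z = g' z"
    and S[measurable]: "S \<in> sets borel" and pos: "0 < measure lborel S"
    and \<phi>[measurable]: "\<phi> \<in> borel_measurable borel"
  shows "normalized_moment \<phi> (uniform_measure lebesgue S) g = normalized_moment \<phi> (uniform_measure lborel S) g'"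
    and "integrable (uniform_measure lebesgue S) g \<longleftrightarrow> integrable (uniform_measure lborel S) g'"
proof -
  have eql: "AE z in lebesgue. g z = g' z" using eq by (simp add: AE_completion)
  have g'l: "g' \<in> borel_measurable lebesgue" by (rule measurable_completion) simp
  have Sl: "S \<in> sets lebesgue" by (rule sets_completionI_sets) simp
  have equ: "AE z in uniform_measure lebesgue S. g z = g' z"
    using eql by (intro AE_uniform_measureI) (auto intro: Sl)
  have gl: "g \<in> borel_measurable lebesgue"
    using borel_measurable_AE[OF g'l, of g] eql by (simp add: eq_commute)
  have posl: "0 < measure lebesgue S" using pos S by simp
  have int: "(\<integral>x. g x \<partial>uniform_measure lebesgue S) = (\<integral>x. g' x \<partial>uniform_measure lborel S)"
  proof -
    have "(\<integral>x. g x \<partial>uniform_measure lebesgue S) = (\<integral>x. g' x \<partial>uniform_measure lebesgue S)"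
      using gl g'l by (intro integral_cong_AE equ) auto
    also have "\<dots> = (\<integral>x. g' x \<partial>uniform_measure lborel S)"
      by (simp add: integral_uniform_measure g'l Sl posl pos set_lebesgue_integral_lebesgue_eq_lborel)
    finally show ?thesis .
  qed
  define c where "c = (\<integral>x. g' x \<partial>uniform_measure lborel S)"
  have "normalized_moment \<phi> (uniform_measure lebesgue S) g = (\<integral>\<^sup>+z. ennreal (\<phi> (g' z / c)) \<partial>uniform_measure lebesgue S)"
    unfolding normalized_moment_def int c_def[symmetric] using equ
    by (intro nn_integral_cong_AE) (auto elim!: eventually_mono)
  also have "\<dots> = (\<integral>\<^sup>+z. ennreal (\<phi> (g' z / c)) \<partial>uniform_measure lborel S)"
    using g'l Sl by (simp add: nn_integral_uniform_measure nn_integral_completion)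
  finally show "normalized_moment \<phi> (uniform_measure lebesgue S) g = normalized_moment \<phi> (uniform_measure lborel S) g'"
    by (simp add: normalized_moment_def c_def)
  have "integrable (uniform_measure lebesgue S) g \<longleftrightarrow> integrable (uniform_measure lebesgue S) g'"
    using gl g'l by (intro integrable_cong_AE equ) auto
  also have "\<dots> \<longleftrightarrow> integrable (uniform_measure lborel S) g'"
    by (simp add: integrable_uniform_measure_iff g'l Sl posl pos set_integrable_def integrable_completion)
  finally show "integrable (uniform_measure lebesgue S) g \<longleftrightarrow> integrable (uniform_measure lborel S) g'" .
qed

lemma AE_lborel_translation:
  fixes c :: "'a::euclidean_space"
  assumes "AE z in lborel. P z"
  shows "AE z in lborel. P (c + z)"
proof -
  obtain N where N: "N \<in> null_sets lborel" "{z. \<not> P z} \<subseteq> N"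
    using assms unfolding eventually_ae_filter by auto
  show ?thesis
  proof (rule AE_I'[OF null_sets_translation[OF N(1), of "- c"]])
    show "{x \<in> space lborel. \<not> P (c + x)} \<subseteq> {x. x - - c \<in> N}"
      using N(2) by (auto simp: add.commute)
  qed
qed

section \<open>Periodization by fractional parts\<close>

definition fracp :: "real \<times> real \<Rightarrow> real \<times> real" where
  "fracp z = (frac (fst z), frac (snd z))"

text \<open>Half-open, so that the integer translates tile the plane and \<open>fracp\<close> is the
  identity on the cell with indices 0, 0.\<close>

definition unit_cell :: "int \<Rightarrow> int \<Rightarrow> (real \<times> real) set" where
  "unit_cell i j = {of_int i..<of_int i + 1} \<times> {of_int j..<of_int j + 1}"

lemma measurable_frac[measurable]: "frac \<in> borel_measurable (borel :: real measure)"
  unfolding frac_def[abs_def] by measurable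

lemma measurable_fracp[measurable]: "fracp \<in> borel \<rightarrow>\<^sub>M borel"
  unfolding fracp_def[abs_def] borel_prod[symmetric] by measurable

lemma borel_unit_cell[measurable]: "unit_cell i j \<in> sets borel"
  unfolding unit_cell_def by (intro borel_Times) auto

lemma fracp_mem: "fracp z \<in> unit_cell 0 0"
  by (simp add: fracp_def unit_cell_def frac_lt_1)

lemma fracp_eq_diff: "fracp z = z - (of_int \<lfloor>fst z\<rfloor>, of_int \<lfloor>snd z\<rfloor>)"
  by (simp add: fracp_def frac_def prod_eq_iff)

lemma fracp_add_int: "fracp ((of_int i, of_int j) + z) = fracp z"
  by (simp add: fracp_def)

lemma fracp_id: "z \<in> unit_cell 0 0 \<Longrightarrow> fracp z = z"
  by (auto simp: fracp_def unit_cell_def)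

text \<open>On each of the countably many integer translates of the cell, \<open>fracp\<close> is a
  translation, so the preimage of a null set is a countable union of null sets.\<close>

lemma AE_lborel_fracp:
  assumes "AE z in lborel. z \<in> unit_cell 0 0 \<longrightarrow> P z"
  shows "AE z in lborel. P (fracp z)"
proof -
  have "AE z in lborel. \<forall>i j. - (of_int i, of_int j) + z \<in> unit_cell 0 0 \<longrightarrow> P (- (of_int i, of_int j) + z)"
    unfolding AE_all_countable by (intro allI AE_lborel_translation assms)
  then show ?thesis
  proof eventually_elim
    case (elim z)
    then show ?case using fracp_mem[of z] unfolding fracp_eq_diff by (metis add.commute diff_conv_add_uminus)
  qed
qed

lemma nn_integral_fracp_unit_cell:
  assumes [measurable]: "k \<in> borel_measurable borel"
  shows "(\<integral>\<^sup>+z. k (fracp z) * indicator (unit_cell i j) z \<partial>lborel) = (\<integral>\<^sup>+z. k z * indicator (unit_cell 0 0) z \<partial>lborel)"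
proof -
  let ?c = "(of_int i, of_int j) :: real \<times> real"
  have "(\<integral>\<^sup>+z. k (fracp z) * indicator (unit_cell i j) z \<partial>lborel)
      = (\<integral>\<^sup>+z. k (fracp z) * indicator (unit_cell i j) z \<partial>distr lborel borel ((+) ?c))"
    by (simp add: lborel_distr_plus)
  also have "\<dots> = (\<integral>\<^sup>+z. k (fracp (?c + z)) * indicator (unit_cell i j) (?c + z) \<partial>lborel)"
    by (rule nn_integral_distr) auto
  also have "\<dots> = (\<integral>\<^sup>+z. k z * indicator (unit_cell 0 0) z \<partial>lborel)"
  proof (rule nn_integral_cong)
    fix z
    have "?c + z \<in> unit_cell i j \<longleftrightarrow> z \<in> unit_cell 0 0"
      by (cases z) (auto simp: unit_cell_def)
    then show "k (fracp (?c + z)) * indicator (unit_cell i j) (?c + z) = k z * indicator (unit_cell 0 0) z"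
      unfolding fracp_add_int by (auto simp: indicator_def fracp_id)
  qed
  finally show ?thesis .
qed

text \<open>The square is tiled by (2 n)^2 unit cells, which all contribute the same
  integral.\<close>

lemma nn_integral_fracp_bounded:
  fixes n :: nat
  assumes k[measurable]: "k \<in> borel_measurable borel"
    and S[measurable]: "S \<in> sets borel" "S \<subseteq> {- real n..<real n} \<times> {- real n..<real n}"
  shows "(\<integral>\<^sup>+z. k (fracp z) * indicator S z \<partial>lborel)
    \<le> of_nat (2 * n * (2 * n)) * (\<integral>\<^sup>+z. k z * indicator (unit_cell 0 0) z \<partial>lborel)"
proof -
  let ?J = "{- int n..<int n} \<times> {- int n..<int n}"
  have "(\<integral>\<^sup>+z. k (fracp z) * indicator S z \<partial>lborel)
      \<le> (\<integral>\<^sup>+z. (\<Sum>(i, j)\<in>?J. k (fracp z) * indicator (unit_cell i j) z) \<partial>lborel)"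
  proof (rule nn_integral_mono)
    fix z
    have "indicator S z \<le> (\<Sum>ij\<in>?J. indicator (unit_cell (fst ij) (snd ij)) z :: ennreal)"
    proof (cases "z \<in> S")
      case True
      let ?ij = "(\<lfloor>fst z\<rfloor>, \<lfloor>snd z\<rfloor>)"
      have z: "- real n \<le> fst z" "fst z < real n" "- real n \<le> snd z" "snd z < real n"
        using S(2) True by auto
      have J: "?ij \<in> ?J" using z by (simp add: le_floor_iff floor_less_iff)
      have zc: "z \<in> unit_cell (fst ?ij) (snd ?ij)"
        by (cases z) (simp add: unit_cell_def)
      have "indicator S z \<le> (indicator (unit_cell (fst ?ij) (snd ?ij)) z :: ennreal)"
        using zc by (simp add: indicator_def)
      also have "\<dots> \<le> (\<Sum>ij\<in>?J. indicator (unit_cell (fst ij) (snd ij)) z)"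
        by (rule member_le_sum[OF J]) auto
      finally show ?thesis .
    qed simp
    then have "k (fracp z) * indicator S z \<le> k (fracp z) * (\<Sum>ij\<in>?J. indicator (unit_cell (fst ij) (snd ij)) z)"
      by (rule mult_left_mono) simp
    then show "k (fracp z) * indicator S z \<le> (\<Sum>(i, j)\<in>?J. k (fracp z) * indicator (unit_cell i j) z)"
      by (simp add: sum_distrib_left case_prod_beta)
  qed
  also have "\<dots> = (\<Sum>(i, j)\<in>?J. \<integral>\<^sup>+z. k (fracp z) * indicator (unit_cell i j) z \<partial>lborel)"
    unfolding case_prod_beta by (rule nn_integral_sum) measurable
  also have "\<dots> = of_nat (2 * n * (2 * n)) * (\<integral>\<^sup>+z. k z * indicator (unit_cell 0 0) z \<partial>lborel)"
    by (simp add: nn_integral_fracp_unit_cell case_prod_beta card_cartesian_product nat_mult_distrib)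
  finally show ?thesis .
qed

text \<open>Integer division rounds down, so the remainder is a legitimate dyadic index for negative
  i too.\<close>

lemma dyadz_eq_translated_dyad:
  "dyadz k i = (+) (of_int (i div 2^k)) ` dyad k (nat (i mod 2^k))"
proof -
  have m: "real (nat (i mod 2^k)) = of_int (i mod 2^k)" by simp
  have "real_of_int i = of_int ((i div 2^k) * 2^k + i mod 2^k)" by (simp only: div_mult_mod_eq)
  also have "\<dots> = of_int (i div 2^k) * 2^k + of_int (i mod 2^k)" by (simp only: of_int_add of_int_mult of_int_power of_int_numeral)
  finally have i: "real_of_int i = of_int (i div 2^k) * 2^k + of_int (i mod 2^k)" .
  have "real_of_int i / 2^k = of_int (i div 2^k) + of_int (i mod 2^k) / 2^k"
    "(real_of_int i + 1) / 2^k = of_int (i div 2^k) + (of_int (i mod 2^k) + 1) / 2^k"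
    by (simp_all add: i add_divide_distrib)
  then show ?thesis unfolding dyadz_def dyad_def m by (simp add: add.commute)
qed

text \<open>Covering a torus rectangle calls for dyadic rectangles anywhere in the plane. An integer
  shift brings them back to the unit cell and leaves \<open>fracp\<close> unchanged.\<close>

lemma normalized_moment_dyadz:
  assumes k[measurable]: "k \<in> borel_measurable borel" and \<phi>: "\<phi> \<in> borel_measurable borel"
    and dy: "\<And>D. D \<in> dyadic_rects \<Longrightarrow> normalized_moment \<phi> (uniform_measure lborel D) (\<lambda>z. k (fracp z)) \<le> K"
  shows "normalized_moment \<phi> (uniform_measure lborel (dyadz k1 i \<times> dyadz k2 j)) (\<lambda>z. k (fracp z)) \<le> K"
proof -
  let ?i = "nat (i mod 2^k1)" and ?j = "nat (j mod 2^k2)"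
  let ?D = "dyad k1 ?i \<times> dyad k2 ?j" and ?c = "(of_int (i div 2^k1), of_int (j div 2^k2)) :: real \<times> real"
  have D: "?D \<in> dyadic_rects"
  proof -
    have "nat (a mod 2^k) < 2^k" for a :: int and k by (simp add: nat_less_iff)
    then show ?thesis unfolding dyadic_rects_def by blast
  qed
  have eq: "dyadz k1 i \<times> dyadz k2 j = (+) ?c ` ?D"
    unfolding dyadz_eq_translated_dyad by (auto simp: image_iff)
  have DS: "?D \<in> sets borel" unfolding dyad_def by (intro borel_Times) auto
  have "normalized_moment \<phi> (uniform_measure lborel ((+) ?c ` ?D)) (\<lambda>z. k (fracp z))
      = normalized_moment \<phi> (uniform_measure lborel ?D) (\<lambda>z. k (fracp (?c + z)))"
    by (rule normalized_moment_translation) (use DS \<phi> in \<open>auto simp flip: eq\<close>)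
  then show ?thesis unfolding eq fracp_add_int using dy[OF D] by simp
qed

subsection \<open>Averages of translated weights\<close>

abbreviation unit_square :: "(real \<times> real) set" where
  "unit_square \<equiv> {0..1} \<times> {0..1}"

lemma borel_unit_square[measurable]: "unit_square \<in> sets borel"
  by (intro borel_Times) auto

lemma measure_unit_square: "measure lborel unit_square = 1"
  by (subst measure_lborel_Times) auto

lemma unit_cell_subset: "unit_cell 0 0 \<subseteq> unit_square"
  by (auto simp: unit_cell_def)

lemma per_eq_fracp: "per f z = f (fst (fracp z)) (snd (fracp z))"
  by (simp add: per_def fracp_def)

lemma per_avgw_eq:
  "per (avgw W) z = set_lebesgue_integral lebesgue unit_square
     (\<lambda>\<sigma>. W (fst \<sigma>) (snd \<sigma>) (fst (fracp (\<sigma> + z))) (snd (fracp (\<sigma> + z))))"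
  by (simp add: per_def avgw_def fracp_def add.commute)

text \<open>W matters only for parameters in the unit square and points of one period, and there it
  is positive almost everywhere. Nonpositive values of a Borel version can thus be overwritten by 1,
  which yields positivity at every point.\<close>

lemma joint_ok_borel_version:
  assumes W: "joint_ok W" and wt: "\<And>s t. s \<in> {0..1} \<Longrightarrow> t \<in> {0..1} \<Longrightarrow> weight (W s t)"
  obtains F :: "(real \<times> real) \<times> (real \<times> real) \<Rightarrow> real"
  where "F \<in> borel_measurable borel" "\<And>u. 0 < F u"
    "AE u in lborel. fst u \<in> unit_square \<longrightarrow> snd u \<in> unit_cell 0 0 \<longrightarrow>
       W (fst (fst u)) (snd (fst u)) (fst (snd u)) (snd (snd u)) = F u"
    "(\<integral>\<^sup>+u. ennreal (F u) * indicator (unit_square \<times> unit_cell 0 0) u \<partial>lborel) < \<infinity>"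
proof -
  define V where "V u = W (fst (fst u)) (snd (fst u)) (fst (snd u)) (snd (snd u))" for u
  have V: "V \<in> borel_measurable lebesgue" "set_integrable lebesgue (unit_square \<times> unit_square) V"
    using W unfolding joint_ok_def V_def[abs_def] by auto
  obtain F0 where F0: "F0 \<in> borel_measurable lborel" "AE u in lborel. V u = F0 u"
    using completion_ex_borel_measurable_real[OF V(1)] by auto
  have F0b[measurable]: "F0 \<in> borel_measurable borel" using F0(1) by simp
  define F where "F u = (if 0 < F0 u then F0 u else 1)" for u
  have F[measurable]: "F \<in> borel_measurable borel" unfolding F_def by measurable
  have Fpos: "0 < F u" for u by (simp add: F_def)
  have VF0: "AE \<sigma> in lborel. AE z in lborel. V (\<sigma>, z) = F0 (\<sigma>, z)"
  proof (rule lborel_pair.AE_pair)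
    show "AE u in lborel \<Otimes>\<^sub>M lborel. V u = F0 u" unfolding lborel_prod by (rule F0(2))
  qed
  \<comment> \<open>Positivity is given for each fixed parameter, so it is transferred slice by
    slice and then reassembled on the product. The reassembly needs a measurable set, which is why
    ?P speaks of F0 and not of V.\<close>
  let ?P = "\<lambda>u. fst u \<in> unit_square \<longrightarrow> snd u \<in> unit_cell 0 0 \<longrightarrow> 0 < F0 u"
  have "AE \<sigma> in lborel. AE z in lborel. ?P (\<sigma>, z)"
    using VF0
  proof eventually_elim
    case (elim \<sigma>)
    show ?case
    proof (cases "\<sigma> \<in> unit_square")
      case True
      then have "weight (W (fst \<sigma>) (snd \<sigma>))" by (intro wt) auto
      then have "AE z in lborel. z \<in> unit_square \<longrightarrow> 0 < per (W (fst \<sigma>) (snd \<sigma>)) z"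
        unfolding weight_def AE_completion_iff by simp
      with elim show ?thesis
      proof eventually_elim
        case (elim z)
        have "0 < F0 (\<sigma>, z)" if z: "z \<in> unit_cell 0 0"
        proof -
          have "0 < per (W (fst \<sigma>) (snd \<sigma>)) z" using elim(2) z unit_cell_subset by blast
          then show ?thesis using elim(1) z by (simp add: per_eq_fracp fracp_id V_def)
        qed
        then show ?case by simp
      qed
    qed simp
  qed
  then have "AE u in lborel \<Otimes>\<^sub>M lborel. ?P u"
  proof (rule lborel_pair.AE_pair_measure[rotated])
    have "{u. ?P u} = - ((unit_square \<times> unit_cell 0 0) \<inter> {u \<in> space borel. F0 u \<le> 0})"
      by (auto simp: not_le)
    also have "\<dots> \<in> sets borel"
      by (intro borel_comp sets.Int borel_Times borel_unit_square borel_unit_cell) measurable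
    finally show "{u \<in> space (lborel \<Otimes>\<^sub>M lborel). ?P u} \<in> sets (lborel \<Otimes>\<^sub>M lborel)"
      unfolding lborel_prod by simp
  qed
  then have P: "AE u in lborel. ?P u" unfolding lborel_prod .
  have VF: "AE u in lborel. fst u \<in> unit_square \<longrightarrow> snd u \<in> unit_cell 0 0 \<longrightarrow> V u = F u"
    using P F0(2) by eventually_elim (auto simp: F_def)
  have "(\<integral>\<^sup>+u. ennreal (F u) * indicator (unit_square \<times> unit_cell 0 0) u \<partial>lborel)
      \<le> (\<integral>\<^sup>+u. ennreal (norm (indicator (unit_square \<times> unit_square) u *\<^sub>R V u)) \<partial>lborel)"
  proof (rule nn_integral_mono_AE)
    show "AE u in lborel. ennreal (F u) * indicator (unit_square \<times> unit_cell 0 0) u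
        \<le> ennreal (norm (indicator (unit_square \<times> unit_square) u *\<^sub>R V u))"
      using VF
    proof eventually_elim
      case (elim u)
      show ?case
      proof (cases "u \<in> unit_square \<times> unit_cell 0 0")
        case True
        then have "V u = F u" using elim by auto
        moreover have "u \<in> unit_square \<times> unit_square" using True unit_cell_subset by blast
        ultimately show ?thesis using True Fpos[of u] by simp
      qed simp
    qed
  qed
  also have "\<dots> = (\<integral>\<^sup>+u. ennreal (norm (indicator (unit_square \<times> unit_square) u *\<^sub>R V u)) \<partial>lebesgue)"
    by (simp add: nn_integral_completion)
  also have "\<dots> < \<infinity>"
    using V(2) unfolding set_integrable_def integrable_iff_bounded by simp
  finally show ?thesis using that F Fpos VF unfolding V_def by blast
qed

text \<open>Unlike the dyadic family, torus rectangles are invariant under translation. Hence a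
  bound for a member on the shifted rectangle is a bound for the shifted member on R.\<close>

lemma torus_rect_translation: "R \<in> torus_rects \<Longrightarrow> (+) c ` R \<in> torus_rects"
proof -
  assume "R \<in> torus_rects"
  then obtain a b l m where R: "R = {a..a+l} \<times> {b..b+m}" "0 < l" "l \<le> 1" "0 < m" "m \<le> 1"
    unfolding torus_rects_def by blast
  obtain c1 c2 where c: "c = (c1, c2)" by (cases c)
  have "(+) c ` R = {(c1+a)..(c1+a)+l} \<times> {(c2+b)..(c2+b)+m}"
  proof (intro equalityI subsetI)
    fix z assume z: "z \<in> {(c1+a)..(c1+a)+l} \<times> {(c2+b)..(c2+b)+m}"
    then have "z - c \<in> R" unfolding R c by auto
    then show "z \<in> (+) c ` R" by (intro image_eqI[of _ _ "z - c"]) auto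
  qed (auto simp: R c)
  then show ?thesis using R unfolding torus_rects_def by blast
qed

lemma torus_rect_borel: "R \<in> torus_rects \<Longrightarrow> R \<in> sets borel"
  unfolding torus_rects_def by (auto intro!: borel_Times)

lemma torus_rect_measure_pos: "R \<in> torus_rects \<Longrightarrow> 0 < measure lborel R"
  unfolding torus_rects_def by (auto simp: measure_lborel_Times)

lemma dyadic_rect_borel: "D \<in> dyadic_rects \<Longrightarrow> D \<in> sets borel"
  unfolding dyadic_rects_def dyad_def by (auto intro!: borel_Times)

lemma dyadic_rect_measure_pos: "D \<in> dyadic_rects \<Longrightarrow> 0 < measure lborel D"
proof -
  have *: "dyad k j = dyadz k (int j)" for k j by (simp add: dyad_def dyadz_def)
  show "D \<in> dyadic_rects \<Longrightarrow> 0 < measure lborel D"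
    unfolding dyadic_rects_def * by (auto simp: measure_dyadz_Times)
qed

lemma dyadic_rect_subset: "D \<in> dyadic_rects \<Longrightarrow> D \<subseteq> unit_square"
proof -
  have "dyad k j \<subseteq> {0..1}" if "j < 2^k" for k j
  proof -
    have "real j + 1 \<le> 2^k" using that by (metis Suc_leI of_nat_Suc of_nat_le_iff of_nat_numeral of_nat_power add.commute)
    then have "(real j + 1) / 2^k \<le> 1" by simp
    moreover have "0 \<le> real j / 2^k" by simp
    ultimately show ?thesis unfolding dyad_def by (intro subsetI) (simp only: atLeastLessThan_iff atLeastAtMost_iff, linarith)
  qed
  then show "D \<in> dyadic_rects \<Longrightarrow> D \<subseteq> unit_square"
    unfolding dyadic_rects_def by blast
qed

lemma bounded_set_in_square:
  assumes "bounded (S :: (real \<times> real) set)"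
  obtains n :: nat where "S \<subseteq> {- real n..<real n} \<times> {- real n..<real n}"
proof -
  obtain B where B: "\<And>z. z \<in> S \<Longrightarrow> norm z \<le> B" using assms unfolding bounded_iff by auto
  obtain n :: nat where n: "B < real n" using reals_Archimedean2 by blast
  have "S \<subseteq> {- real n..<real n} \<times> {- real n..<real n}"
  proof
    fix z assume "z \<in> S"
    then have "norm z < real n" using B n by fastforce
    then have "\<bar>fst z\<bar> < real n" "\<bar>snd z\<bar> < real n"
      using norm_fst_le[of "fst z" "snd z"] norm_snd_le[of "snd z" "fst z"] by auto
    then show "z \<in> {- real n..<real n} \<times> {- real n..<real n}" by (cases z) auto
  qed
  then show ?thesis by (rule that)
qed

lemma set_integrable_fracp:
  fixes f :: "real \<times> real \<Rightarrow> real"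
  assumes [measurable]: "f \<in> borel_measurable borel" "S \<in> sets borel" and pos: "\<And>z. 0 < f z"
    and S: "bounded S"
    and fin: "(\<integral>\<^sup>+z. ennreal (f z) * indicator (unit_cell 0 0) z \<partial>lborel) < \<infinity>"
  shows "set_integrable lborel S (\<lambda>z. f (fracp z))"
proof -
  obtain n :: nat where n: "S \<subseteq> {- real n..<real n} \<times> {- real n..<real n}"
    using bounded_set_in_square[OF S] .
  have "(\<integral>\<^sup>+z. ennreal (norm (indicator S z *\<^sub>R f (fracp z))) \<partial>lborel) = (\<integral>\<^sup>+z. ennreal (f (fracp z)) * indicator S z \<partial>lborel)"
    using pos by (intro nn_integral_cong) (auto simp: indicator_def less_imp_le)
  also have "\<dots> \<le> of_nat (2 * n * (2 * n)) * (\<integral>\<^sup>+z. ennreal (f z) * indicator (unit_cell 0 0) z \<partial>lborel)"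
    using nn_integral_fracp_bounded[where k = "\<lambda>z. ennreal (f z)" and S = S and n = n] n by simp
  also have "\<dots> < \<infinity>" using fin by (simp add: ennreal_mult_less_top ennreal_of_nat_eq_real_of_nat)
  finally show ?thesis unfolding set_integrable_def integrable_iff_bounded by simp
qed

text \<open>The periodic extension of f agrees almost everywhere in the plane with the Borel
  function F composed with \<open>fracp\<close>, to which the doubling argument applies.\<close>

lemma normalized_moment_doubling_per:
  fixes F :: "real \<times> real \<Rightarrow> real"
  assumes f: "weight f" "doubling C (per f)"
    and F[measurable]: "F \<in> borel_measurable borel" and pos: "\<And>z. 0 < F z"
    and eq: "AE z in lborel. z \<in> unit_cell 0 0 \<longrightarrow> f (fst z) (snd z) = F z"
    and \<phi>[measurable]: "\<phi> \<in> borel_measurable borel" "\<psi> \<in> borel_measurable borel"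
    and nonneg: "\<And>x. 0 < x \<Longrightarrow> 0 \<le> \<phi> x"
    and AB: "0 \<le> A" "0 \<le> B" "0 \<le> K"
    and moment: "\<And>D. D \<in> dyadic_rects \<Longrightarrow> normalized_moment \<phi> (uniform_measure lebesgue D) (per f) \<le> ennreal K"
    and M: "M = 256 * max C 1 ^ 6"
    and dilate: "\<And>q x. 1 / M \<le> q \<Longrightarrow> q \<le> M \<Longrightarrow> 0 < x \<Longrightarrow> \<psi> (q * x) \<le> A * \<phi> x + B * (x + 1)"
    and R: "R \<in> torus_rects"
  shows "normalized_moment \<psi> (uniform_measure lborel R) (\<lambda>z. F (fracp z)) \<le> ennreal (5 * (A * K + 2 * B))"
proof -
  let ?g = "\<lambda>z. F (fracp z)"
  have perF: "AE z in lborel. per f z = ?g z"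
    using AE_lborel_fracp[OF eq] by (simp add: per_eq_fracp)
  have g[measurable]: "?g \<in> borel_measurable borel" by measurable
  have fin: "(\<integral>\<^sup>+z. ennreal (F z) * indicator (unit_cell 0 0) z \<partial>lborel) < \<infinity>"
  proof -
    have "(\<integral>\<^sup>+z. ennreal (F z) * indicator (unit_cell 0 0) z \<partial>lborel)
      \<le> (\<integral>\<^sup>+z. ennreal (norm (indicator unit_square z *\<^sub>R per f z)) \<partial>lborel)"
    proof (rule nn_integral_mono_AE)
      show "AE z in lborel. ennreal (F z) * indicator (unit_cell 0 0) z \<le> ennreal (norm (indicator unit_square z *\<^sub>R per f z))"
        using eq
      proof eventually_elim
        case (elim z)
        show ?case
        proof (cases "z \<in> unit_cell 0 0")
          case True
          then have "per f z = F z" using elim by (simp add: per_eq_fracp fracp_id)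
          moreover have "z \<in> unit_square" using True unit_cell_subset by blast
          ultimately show ?thesis using True pos[of z] by simp
        qed simp
      qed
    qed
    also have "\<dots> = (\<integral>\<^sup>+z. ennreal (norm (indicator unit_square z *\<^sub>R per f z)) \<partial>lebesgue)"
      by (simp add: nn_integral_completion)
    also have "\<dots> < \<infinity>"
      using f(1) unfolding weight_def set_integrable_def integrable_iff_bounded by simp
    finally show ?thesis .
  qed
  have perl: "per f \<in> borel_measurable lebesgue"
  proof (rule borel_measurable_AE)
    show "?g \<in> borel_measurable lebesgue" by (rule measurable_completion) simp
    show "AE z in lebesgue. ?g z = per f z" using perF by (simp add: AE_completion_iff eq_commute)
  qed
  have gl: "?g \<in> borel_measurable lebesgue" by (rule measurable_completion) simp
  have "set_lebesgue_integral lebesgue S (per f) = set_lebesgue_integral lebesgue S ?g" if S: "S \<in> sets borel" for S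
    unfolding set_lebesgue_integral_def
  proof (rule integral_cong_AE)
    have [measurable]: "S \<in> sets lebesgue" using S by simp
    show "(\<lambda>z. indicat_real S z *\<^sub>R per f z) \<in> borel_measurable lebesgue" using perl by measurable
    show "(\<lambda>z. indicat_real S z *\<^sub>R ?g z) \<in> borel_measurable lebesgue" using gl by measurable
    show "AE z in lebesgue. indicat_real S z *\<^sub>R per f z = indicat_real S z *\<^sub>R ?g z"
      unfolding AE_completion_iff using perF by eventually_elim simp
  qed
  then have "set_lebesgue_integral lebesgue ({a..b} \<times> {c..d}) (per f) = set_lebesgue_integral lebesgue ({a..b} \<times> {c..d}) ?g"
    for a b c d :: real by (simp add: borel_Times)
  then have dbl: "doubling C ?g" using f(2) unfolding doubling_def by simp
  show ?thesis
  proof (rule normalized_moment_doubling[OF g _ _ dbl \<phi> nonneg AB _ M dilate R])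
    show "set_integrable lborel ({a..b} \<times> {c..d}) ?g" for a b c d
      by (rule set_integrable_fracp) (use fin in \<open>auto simp: pos intro!: borel_Times bounded_Times\<close>)
    show "normalized_moment \<phi> (uniform_measure lborel (dyadz k1 i \<times> dyadz k2 j)) ?g \<le> ennreal K" for k1 i k2 j
    proof (rule normalized_moment_dyadz[OF F \<phi>(1)])
      fix D assume D: "D \<in> dyadic_rects"
      show "normalized_moment \<phi> (uniform_measure lborel D) ?g \<le> ennreal K"
        using moment[OF D] normalized_moment_lebesgue_eq_lborel(1)[OF g perF dyadic_rect_borel[OF D] dyadic_rect_measure_pos[OF D] \<phi>(1)]
        by simp
    qed
  qed (auto simp: pos)
qed

text \<open>For almost every parameter the translated member obeys the bound on R, because the
  member obeys it on the translated rectangle; the Jensen lemma then averages. Most of the work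
  relates \<open>avgw W\<close>, built from W itself, to the average G of the Borel version, and
  shows h to be integrable.\<close>

lemma normalized_moment_avgw:
  assumes W: "joint_ok W"
    and wt: "\<And>s t. s \<in> {0..1} \<Longrightarrow> t \<in> {0..1} \<Longrightarrow> weight (W s t)"
    and dbl: "\<And>s t. s \<in> {0..1} \<Longrightarrow> t \<in> {0..1} \<Longrightarrow> doubling C (per (W s t))"
    and \<phi>[measurable]: "\<phi> \<in> borel_measurable borel" "\<psi> \<in> borel_measurable borel"
    and nonneg: "\<And>x. 0 < x \<Longrightarrow> 0 \<le> \<phi> x" "\<And>x. 0 < x \<Longrightarrow> 0 \<le> \<psi> x"
    and convex: "convex_on {0<..} \<psi>"
    and AB: "0 \<le> A" "0 \<le> B" "0 \<le> K"
    and moment: "\<And>s t D. s \<in> {0..1} \<Longrightarrow> t \<in> {0..1} \<Longrightarrow> D \<in> dyadic_rects \<Longrightarrow>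
      normalized_moment \<phi> (uniform_measure lebesgue D) (per (W s t)) \<le> ennreal K"
    and M: "M = 256 * max C 1 ^ 6"
    and dilate: "\<And>q x. 1 / M \<le> q \<Longrightarrow> q \<le> M \<Longrightarrow> 0 < x \<Longrightarrow> \<psi> (q * x) \<le> A * \<phi> x + B * (x + 1)"
    and R: "R \<in> torus_rects"
  shows "per (avgw W) \<in> borel_measurable lebesgue"
    and "integrable (uniform_measure lebesgue R) (per (avgw W))"
    and "AE z in uniform_measure lebesgue R. 0 < per (avgw W) z"
    and "normalized_moment \<psi> (uniform_measure lebesgue R) (per (avgw W)) \<le> ennreal (5 * (A * K + 2 * B))"
proof -
  define V where "V u = W (fst (fst u)) (snd (fst u)) (fst (snd u)) (snd (snd u))" for u
  obtain F where F[measurable]: "F \<in> borel_measurable borel" and pos: "\<And>u. 0 < F u"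
    and VF: "AE u in lborel. fst u \<in> unit_square \<longrightarrow> snd u \<in> unit_cell 0 0 \<longrightarrow> V u = F u"
    and fin: "(\<integral>\<^sup>+u. ennreal (F u) * indicator (unit_square \<times> unit_cell 0 0) u \<partial>lborel) < \<infinity>"
    unfolding V_def using joint_ok_borel_version[OF W wt] by blast
  \<comment> \<open>Up to null sets this is the integrand of \<open>avgw\<close>; it is Borel
    jointly in parameter and point because F and the map in \<open>shear\<close> are.\<close>
  define h where "h u = F (fst u, fracp (fst u + snd u))" for u
  have shear: "(\<lambda>u. (fst u, fracp (fst u + snd u))) \<in> borel \<rightarrow>\<^sub>M (borel :: ((real \<times> real) \<times> (real \<times> real)) measure)"
  proof (rule borel_measurable_Pair)
    show "fst \<in> borel \<rightarrow>\<^sub>M (borel :: (real \<times> real) measure)"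
      by (intro borel_measurable_continuous_onI continuous_intros)
    have "(\<lambda>u. fst u + snd u) \<in> borel \<rightarrow>\<^sub>M (borel :: (real \<times> real) measure)"
      by (intro borel_measurable_continuous_onI continuous_intros)
    then show "(\<lambda>u. fracp (fst u + snd u)) \<in> borel \<rightarrow>\<^sub>M borel"
      by (rule measurable_compose[OF _ measurable_fracp])
  qed
  have h[measurable]: "h \<in> borel_measurable borel"
    unfolding h_def by (rule measurable_compose[OF shear F])
  define P where "P = uniform_measure lborel unit_square"
  define N where "N = uniform_measure lborel R"
  note Rb[measurable] = torus_rect_borel[OF R] and Rpos = torus_rect_measure_pos[OF R]
  have sP[measurable_cong]: "sets P = sets borel" and sN[measurable_cong]: "sets N = sets borel"
    by (simp_all add: P_def N_def)
  interpret P: prob_space P unfolding P_def by (rule prob_space_uniform_measure_pos) (simp add: measure_unit_square)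
  interpret N: prob_space N unfolding N_def by (rule prob_space_uniform_measure_pos[OF Rpos])
  interpret PN: pair_prob_space P N ..
  have hPN[measurable]: "h \<in> borel_measurable (P \<Otimes>\<^sub>M N)"
  proof -
    have eq: "sets (P \<Otimes>\<^sub>M N) = sets borel"
      using sets_pair_measure_cong[OF sP sN] by (simp only: borel_prod)
    show ?thesis unfolding measurable_cong_sets[OF eq refl] by (rule h)
  qed
  have h': "(\<lambda>u. h (snd u, fst u)) \<in> borel_measurable (borel \<Otimes>\<^sub>M P)"
  proof -
    have "(\<lambda>u. (snd u, fst u)) \<in> borel \<rightarrow>\<^sub>M (borel :: ((real \<times> real) \<times> (real \<times> real)) measure)"
      by (intro borel_measurable_continuous_onI continuous_intros)
    then have "(\<lambda>u. h (snd u, fst u)) \<in> borel_measurable borel" by (rule measurable_compose[OF _ h])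
    moreover have eq: "sets ((borel :: (real \<times> real) measure) \<Otimes>\<^sub>M P) = sets borel"
      using sets_pair_measure_cong[OF refl[of "sets (borel :: (real \<times> real) measure)"] sP] by (simp only: borel_prod)
    ultimately show ?thesis unfolding measurable_cong_sets[OF eq refl] by simp
  qed
  have F1: "(\<lambda>z. F (\<sigma>, z)) \<in> borel_measurable borel" for \<sigma>
    by (rule measurable_compose[OF _ F]) (intro borel_measurable_continuous_onI continuous_intros)
  have h1: "(\<lambda>z. h (\<sigma>, z)) \<in> borel_measurable borel" for \<sigma>
    by (rule measurable_compose[OF _ h]) (intro borel_measurable_continuous_onI continuous_intros)
  have h2: "(\<lambda>\<sigma>. h (\<sigma>, z)) \<in> borel_measurable borel" for z
    by (rule measurable_compose[OF _ h]) (intro borel_measurable_continuous_onI continuous_intros)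
  define G where "G z = (\<integral>\<sigma>. h (\<sigma>, z) \<partial>P)" for z
  have G[measurable]: "G \<in> borel_measurable borel"
    unfolding G_def by (rule P.borel_measurable_lebesgue_integral) (use h' in \<open>simp add: case_prod_beta\<close>)

  \<comment> \<open>The set where V and F differ need not be Borel, but exchanging the two
    almost-everywhere quantifiers below requires a measurable set; hence a Borel null set containing
    it.\<close>
  obtain N0 where N0: "N0 \<in> null_sets lborel"
    "{u. \<not> (fst u \<in> unit_square \<longrightarrow> snd u \<in> unit_cell 0 0 \<longrightarrow> V u = F u)} \<subseteq> N0"
    using VF unfolding eventually_ae_filter by auto
  have "AE \<sigma> in lborel. AE z in lborel. (\<sigma>, z) \<notin> N0"
  proof (rule lborel_pair.AE_pair)
    show "AE u in lborel \<Otimes>\<^sub>M lborel. u \<notin> N0" unfolding lborel_prod by (rule AE_not_in[OF N0(1)])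
  qed
  \<comment> \<open>For a fixed parameter the slice of N0 is null, and it remains so under pulling
    back by \<open>fracp\<close> and by a translation.\<close>
  then have "AE \<sigma> in lborel. AE z in lborel. (\<sigma>, fracp (\<sigma> + z)) \<notin> N0"
  proof eventually_elim
    case (elim \<sigma>)
    then have "AE z in lborel. (\<sigma>, fracp z) \<notin> N0"
      by (intro AE_lborel_fracp) (auto elim: eventually_mono)
    then show ?case by (rule AE_lborel_translation)
  qed
  also have "?this \<longleftrightarrow> (AE z in lborel. AE \<sigma> in lborel. (\<sigma>, fracp (\<sigma> + z)) \<notin> N0)"
  proof (rule lborel_pair.AE_commute)
    have "- N0 \<in> sets borel" using N0(1) by (auto simp: null_sets_def)
    then have "(\<lambda>u. (fst u, fracp (fst u + snd u))) -` (- N0) \<inter> space borel \<in> sets borel"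
      by (rule measurable_sets[OF shear])
    then show "{x \<in> space (lborel \<Otimes>\<^sub>M lborel). (fst x, fracp (fst x + snd x)) \<notin> N0} \<in> sets (lborel \<Otimes>\<^sub>M lborel)"
      unfolding lborel_prod by (simp add: vimage_def)
  qed
  finally have VhAE: "AE z in lborel. AE \<sigma> in lborel. \<sigma> \<in> unit_square \<longrightarrow> V (\<sigma>, fracp (\<sigma> + z)) = h (\<sigma>, z)"
  proof eventually_elim
    case (elim z)
    then show ?case
    proof eventually_elim
      case (elim \<sigma>)
      have "(\<sigma>, fracp (\<sigma> + z)) \<notin> {u. \<not> (fst u \<in> unit_square \<longrightarrow> snd u \<in> unit_cell 0 0 \<longrightarrow> V u = F u)}"
        by (rule contra_subsetD[OF N0(2) elim])
      then show ?case by (simp add: fracp_mem h_def)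
    qed
  qed
  have GAE: "AE z in lborel. per (avgw W) z = G z"
    using VhAE
  proof eventually_elim
    case (elim z)
    have hl: "(\<lambda>\<sigma>. indicat_real unit_square \<sigma> *\<^sub>R h (\<sigma>, z)) \<in> borel_measurable lebesgue"
      by (rule measurable_completion) (use h2 borel_unit_square in simp)
    have ae: "AE \<sigma> in lebesgue. indicat_real unit_square \<sigma> *\<^sub>R h (\<sigma>, z)
        = indicat_real unit_square \<sigma> *\<^sub>R V (\<sigma>, fracp (\<sigma> + z))"
      unfolding AE_completion_iff using elim by eventually_elim (auto simp: indicator_def)
    \<comment> \<open>Measurability of V along this curve of arguments comes from completeness: it
      agrees almost everywhere with the Borel function h.\<close>
    have Vl: "(\<lambda>\<sigma>. indicat_real unit_square \<sigma> *\<^sub>R V (\<sigma>, fracp (\<sigma> + z))) \<in> borel_measurable lebesgue"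
      by (rule borel_measurable_AE[OF hl ae])
    have "per (avgw W) z = set_lebesgue_integral lebesgue unit_square (\<lambda>\<sigma>. V (\<sigma>, fracp (\<sigma> + z)))"
      by (simp add: per_avgw_eq V_def)
    also have "\<dots> = set_lebesgue_integral lebesgue unit_square (\<lambda>\<sigma>. h (\<sigma>, z))"
      unfolding set_lebesgue_integral_def by (rule integral_cong_AE[OF hl Vl ae, symmetric])
    also have "\<dots> = G z"
      unfolding G_def P_def
      by (subst integral_uniform_measure) (simp_all add: measure_unit_square h2 set_lebesgue_integral_lebesgue_eq_lborel)
    finally show ?case .
  qed

  have hi: "integrable (P \<Otimes>\<^sub>M N) h"
  proof (rule integrableI_nonneg)
    let ?J = "\<lambda>\<sigma>. \<integral>\<^sup>+w. ennreal (F (\<sigma>, w)) * indicator (unit_cell 0 0) w \<partial>lborel"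
    \<comment> \<open>The sum set of the unit square and R is bounded, so one n, and hence one
      number of cells, serves all parameters.\<close>
    have "bounded ((\<lambda>(x, y). x + y) ` (unit_square \<times> R))"
      using R unfolding torus_rects_def by (intro bounded_plus) (auto intro!: bounded_Times)
    then obtain n :: nat where n: "(\<lambda>(x, y). x + y) ` (unit_square \<times> R) \<subseteq> {- real n..<real n} \<times> {- real n..<real n}"
      by (rule bounded_set_in_square)
    let ?c = "of_nat (2 * n * (2 * n)) * inverse (emeasure lborel R)"
    have inner: "(\<integral>\<^sup>+z. ennreal (h (\<sigma>, z)) \<partial>N) \<le> ?c * ?J \<sigma>" if \<sigma>: "\<sigma> \<in> unit_square" for \<sigma>
    proof -
      note [measurable] = torus_rect_borel[OF torus_rect_translation[OF R, of \<sigma>]] F1[of \<sigma>]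
      have "(+) \<sigma> ` R \<subseteq> (\<lambda>(x, y). x + y) ` (unit_square \<times> R)"
      proof (rule image_subsetI)
        fix z assume "z \<in> R"
        then show "\<sigma> + z \<in> (\<lambda>(x, y). x + y) ` (unit_square \<times> R)"
          using \<sigma> by (intro image_eqI[of _ _ "(\<sigma>, z)"]) simp_all
      qed
      then have sub: "(+) \<sigma> ` R \<subseteq> {- real n..<real n} \<times> {- real n..<real n}" using n by (rule order_trans)
      have "(\<integral>\<^sup>+z. ennreal (h (\<sigma>, z)) * indicator R z \<partial>lborel)
          = (\<integral>\<^sup>+z. ennreal (F (\<sigma>, fracp (\<sigma> + z))) * indicator ((+) \<sigma> ` R) (\<sigma> + z) \<partial>lborel)"
        by (intro nn_integral_cong) (auto simp: h_def indicator_def image_iff)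
      also have "\<dots> = (\<integral>\<^sup>+z. ennreal (F (\<sigma>, fracp z)) * indicator ((+) \<sigma> ` R) z \<partial>distr lborel borel ((+) \<sigma>))"
        by (subst nn_integral_distr) auto
      also have "\<dots> = (\<integral>\<^sup>+z. ennreal (F (\<sigma>, fracp z)) * indicator ((+) \<sigma> ` R) z \<partial>lborel)"
        by (simp add: lborel_distr_plus)
      also have "\<dots> \<le> of_nat (2 * n * (2 * n)) * ?J \<sigma>"
        by (rule nn_integral_fracp_bounded[where k = "\<lambda>w. ennreal (F (\<sigma>, w))"]) (use sub in auto)
      finally have "(\<integral>\<^sup>+z. ennreal (h (\<sigma>, z)) * indicator R z \<partial>lborel) * inverse (emeasure lborel R)
          \<le> of_nat (2 * n * (2 * n)) * ?J \<sigma> * inverse (emeasure lborel R)"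
        by (rule mult_right_mono) simp
      then show ?thesis
        unfolding N_def using h1[of \<sigma>]
        by (subst nn_integral_uniform_measure) (auto simp: divide_ennreal_def ac_simps)
    qed
    have e0: "emeasure lborel R \<noteq> 0" using Rpos by (auto simp: measure_def)
    have "(\<lambda>u. ennreal (F u) * indicator (unit_square \<times> unit_cell 0 0) u) \<in> borel_measurable borel"
      using borel_Times[OF borel_unit_square borel_unit_cell] by measurable
    then have mF: "(\<lambda>u. ennreal (F u) * indicator (unit_square \<times> unit_cell 0 0) u) \<in> borel_measurable (lborel \<Otimes>\<^sub>M lborel)"
      unfolding lborel_prod by simp
    have FJ: "(\<integral>\<^sup>+u. ennreal (F u) * indicator (unit_square \<times> unit_cell 0 0) u \<partial>lborel)
        = (\<integral>\<^sup>+\<sigma>. ?J \<sigma> * indicator unit_square \<sigma> \<partial>lborel)"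
    proof -
      have "(\<integral>\<^sup>+u. ennreal (F u) * indicator (unit_square \<times> unit_cell 0 0) u \<partial>lborel)
          = (\<integral>\<^sup>+u. ennreal (F u) * indicator (unit_square \<times> unit_cell 0 0) u \<partial>(lborel \<Otimes>\<^sub>M lborel))"
        unfolding lborel_prod ..
      also have "\<dots> = (\<integral>\<^sup>+\<sigma>. \<integral>\<^sup>+w. ennreal (F (\<sigma>, w)) * indicator (unit_square \<times> unit_cell 0 0) (\<sigma>, w) \<partial>lborel \<partial>lborel)"
        using lborel.nn_integral_fst[OF mF] by simp
      also have "\<dots> = (\<integral>\<^sup>+\<sigma>. ?J \<sigma> * indicator unit_square \<sigma> \<partial>lborel)"
        by (intro nn_integral_cong) (auto simp: indicator_def)
      finally show ?thesis .
    qed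
    have mJ: "(\<lambda>\<sigma>. ?J \<sigma> * indicator unit_square \<sigma>) \<in> borel_measurable lborel"
    proof -
      have "(\<lambda>\<sigma>. \<integral>\<^sup>+w. ennreal (F (\<sigma>, w)) * indicator (unit_square \<times> unit_cell 0 0) (\<sigma>, w) \<partial>lborel) \<in> borel_measurable lborel"
        using lborel.borel_measurable_nn_integral_fst[OF mF] by simp
      also have "(\<lambda>\<sigma>. \<integral>\<^sup>+w. ennreal (F (\<sigma>, w)) * indicator (unit_square \<times> unit_cell 0 0) (\<sigma>, w) \<partial>lborel)
          = (\<lambda>\<sigma>. ?J \<sigma> * indicator unit_square \<sigma>)"
        by (auto simp: indicator_def fun_eq_iff)
      finally show ?thesis .
    qed
    have "(\<integral>\<^sup>+u. ennreal (h u) \<partial>(P \<Otimes>\<^sub>M N)) = (\<integral>\<^sup>+\<sigma>. \<integral>\<^sup>+z. ennreal (h (\<sigma>, z)) \<partial>N \<partial>P)"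
      by (rule N.nn_integral_fst[symmetric]) measurable
    also have "\<dots> \<le> (\<integral>\<^sup>+\<sigma>. ?c * (?J \<sigma> * indicator unit_square \<sigma>) \<partial>P)"
    proof (rule nn_integral_mono_AE)
      have "AE \<sigma> in P. \<sigma> \<in> unit_square"
        unfolding P_def by (rule AE_uniform_measureI) auto
      then show "AE \<sigma> in P. (\<integral>\<^sup>+z. ennreal (h (\<sigma>, z)) \<partial>N) \<le> ?c * (?J \<sigma> * indicator unit_square \<sigma>)"
        by eventually_elim (use inner in simp)
    qed
    also have "\<dots> = (\<integral>\<^sup>+\<sigma>. ?c * (?J \<sigma> * indicator unit_square \<sigma>) * indicator unit_square \<sigma> \<partial>lborel) / emeasure lborel unit_square"
      unfolding P_def by (rule nn_integral_uniform_measure) (use mJ in auto)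
    also have "emeasure lborel unit_square = 1"
    proof -
      have "emeasure lborel unit_square \<noteq> top" using measure_unit_square by (auto simp: measure_def)
      then have "emeasure lborel unit_square = ennreal (measure lborel unit_square)"
        by (rule emeasure_eq_ennreal_measure)
      then show ?thesis unfolding measure_unit_square by simp
    qed
    also have "(\<integral>\<^sup>+\<sigma>. ?c * (?J \<sigma> * indicator unit_square \<sigma>) * indicator unit_square \<sigma> \<partial>lborel) / 1
        = (\<integral>\<^sup>+\<sigma>. ?c * (?J \<sigma> * indicator unit_square \<sigma>) \<partial>lborel)"
      by (simp add: divide_ennreal_def) (intro nn_integral_cong, simp add: indicator_def)
    also have "\<dots> = ?c * (\<integral>\<^sup>+\<sigma>. ?J \<sigma> * indicator unit_square \<sigma> \<partial>lborel)"
      using mJ by (rule nn_integral_cmult)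
    also have "\<dots> < \<infinity>"
    proof -
      have "inverse (emeasure lborel R) < top"
        using e0 by (simp add: less_top[symmetric] ennreal_inverse_eq_top_iff)
      moreover have "of_nat (2 * n * (2 * n)) < (top :: ennreal)"
        unfolding ennreal_of_nat_eq_real_of_nat by simp
      ultimately show ?thesis
        unfolding FJ[symmetric] using fin by (simp add: ennreal_mult_less_top)
    qed
    finally show "(\<integral>\<^sup>+u. ennreal (h u) \<partial>(P \<Otimes>\<^sub>M N)) < \<infinity>" .
  qed (use pos in \<open>auto simp: h_def less_imp_le\<close>)

  have "AE \<sigma> in lborel. AE z in lborel. fst (\<sigma>, z) \<in> unit_square \<longrightarrow> snd (\<sigma>, z) \<in> unit_cell 0 0 \<longrightarrow> V (\<sigma>, z) = F (\<sigma>, z)"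
  proof (rule lborel_pair.AE_pair)
    show "AE u in lborel \<Otimes>\<^sub>M lborel. fst u \<in> unit_square \<longrightarrow> snd u \<in> unit_cell 0 0 \<longrightarrow> V u = F u"
      unfolding lborel_prod by (rule VF)
  qed
  then have "AE \<sigma> in lborel. \<sigma> \<in> unit_square \<longrightarrow> normalized_moment \<psi> N (\<lambda>z. h (\<sigma>, z)) \<le> ennreal (5 * (A * K + 2 * B))"
  proof eventually_elim
    case (elim \<sigma>)
    show ?case
    proof
      assume \<sigma>: "\<sigma> \<in> unit_square"
      then have s: "fst \<sigma> \<in> {0..1}" "snd \<sigma> \<in> {0..1}" by auto
      have eq: "AE z in lborel. z \<in> unit_cell 0 0 \<longrightarrow> W (fst \<sigma>) (snd \<sigma>) (fst z) (snd z) = F (\<sigma>, z)"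
        using elim \<sigma> by (simp add: V_def)
      have F\<sigma>: "(\<lambda>z. F (\<sigma>, fracp z)) \<in> borel_measurable borel"
        by (rule measurable_compose[OF measurable_fracp F1])
      have "normalized_moment \<psi> (uniform_measure lborel ((+) \<sigma> ` R)) (\<lambda>z. F (\<sigma>, fracp z)) \<le> ennreal (5 * (A * K + 2 * B))"
        by (rule normalized_moment_doubling_per[OF wt[OF s] dbl[OF s] F1 pos eq \<phi> nonneg(1) AB moment[OF s] M dilate torus_rect_translation[OF R]])
      then show "normalized_moment \<psi> N (\<lambda>z. h (\<sigma>, z)) \<le> ennreal (5 * (A * K + 2 * B))"
        using normalized_moment_translation[OF Rb torus_rect_borel[OF torus_rect_translation[OF R, of \<sigma>]] F\<sigma> \<phi>(2)]
        by (simp add: N_def h_def)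
    qed
  qed
  then have le: "AE \<sigma> in P. normalized_moment \<psi> N (\<lambda>z. h (\<sigma>, z)) \<le> ennreal (5 * (A * K + 2 * B))"
    unfolding P_def by (intro AE_uniform_measureI) auto
  have momG: "normalized_moment \<psi> N G \<le> ennreal (5 * (A * K + 2 * B))"
    unfolding G_def
    by (rule normalized_moment_average_le[OF P.prob_space_axioms N.prob_space_axioms hPN hi _ \<phi>(2) convex nonneg(2) le])
      (simp_all add: h_def pos)
  have Gi: "integrable N G"
    unfolding G_def using PN.integrable_snd[of "\<lambda>s z. h (s, z)"] hi by simp
  \<comment> \<open>Almost every section is integrable; for a divergent one the Bochner integral
    would be 0 despite the positive integrand.\<close>
  have "AE z in N. 0 < G z"
    using PN.AE_integrable_snd[of "\<lambda>s z. h (s, z)", simplified, OF hi]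
    by eventually_elim (auto simp: G_def h_def pos intro!: P.expectation_greater)
  then have Gpos: "AE z in lborel. z \<in> R \<longrightarrow> 0 < G z"
    unfolding N_def using Rpos by (subst (asm) AE_uniform_measure) (auto simp: measure_def less_top[symmetric])

  note eqs = normalized_moment_lebesgue_eq_lborel[OF G GAE Rb Rpos]
  show "per (avgw W) \<in> borel_measurable lebesgue"
  proof (rule borel_measurable_AE)
    show "G \<in> borel_measurable lebesgue" by (rule measurable_completion) simp
    show "AE z in lebesgue. G z = per (avgw W) z" using GAE by (simp add: AE_completion_iff eq_commute)
  qed
  show "integrable (uniform_measure lebesgue R) (per (avgw W))"
    using Gi eqs(2)[OF \<phi>(2)] by (simp add: N_def)
  show "AE z in uniform_measure lebesgue R. 0 < per (avgw W) z"
  proof (rule AE_uniform_measureI)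
    show "AE z in lebesgue. z \<in> R \<longrightarrow> 0 < per (avgw W) z"
      unfolding AE_completion_iff using GAE Gpos by eventually_elim simp
  qed (use Rb in simp)
  show "normalized_moment \<psi> (uniform_measure lebesgue R) (per (avgw W)) \<le> ennreal (5 * (A * K + 2 * B))"
    using momG eqs(1)[OF \<phi>(2)] by (simp add: N_def)
qed

subsection \<open>Product Muckenhoupt and reverse Hoelder conditions as moment bounds\<close>

text \<open>As f is only Lebesgue measurable, composing with \<open>frac\<close> needs an argument:
  a Borel version agrees with f off a null set, and the preimage of that set under
  \<open>fracp\<close> is null.\<close>

lemma weight_per_measurable:
  assumes "weight f"
  shows "per f \<in> borel_measurable lebesgue"
proof -
  obtain F where F: "F \<in> borel_measurable lborel" "AE z in lborel. f (fst z) (snd z) = F z"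
    using completion_ex_borel_measurable_real assms unfolding weight_def by blast
  have "AE z in lborel. z \<in> unit_cell 0 0 \<longrightarrow> f (fst z) (snd z) = F z" using F(2) by auto
  from AE_lborel_fracp[OF this] have eq: "AE z in lborel. per f z = F (fracp z)"
    by (simp add: per_eq_fracp)
  show ?thesis
  proof (rule borel_measurable_AE)
    show "(\<lambda>z. F (fracp z)) \<in> borel_measurable lebesgue"
      using F(1) by (intro measurable_completion) simp
    show "AE z in lebesgue. F (fracp z) = per f z" using eq by (simp add: AE_completion_iff eq_commute)
  qed
qed

lemma powr_le_iff:
  fixes a b r :: real
  assumes "0 < r" "0 \<le> a" "0 \<le> b"
  shows "a powr r \<le> b powr r \<longleftrightarrow> a \<le> b"
  using assms powr_mono2[of r a b] powr_less_mono2[of r b a] by force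

text \<open>Common ground for a member of the family on a dyadic rectangle and for the average on an
  arbitrary one. Each condition is translated into a moment bound once, and the equivalence is read
  forwards on the former and backwards on the latter.\<close>

locale weight_on_set =
  fixes S :: "(real \<times> real) set" and g :: "real \<times> real \<Rightarrow> real"
  assumes S: "S \<in> sets borel" "0 < measure lborel S"
    and g: "g \<in> borel_measurable lebesgue" "integrable (uniform_measure lebesgue S) g"
    and pos: "AE z in uniform_measure lebesgue S. 0 < g z"
begin

sublocale prob_space "uniform_measure lebesgue S"
  using S by (intro prob_space_uniform_measure_pos) simp

lemma avg_eq_expectation: "k \<in> borel_measurable lebesgue \<Longrightarrow> avg S k = expectation k"
  using S by (simp add: avg_def integral_uniform_measure)

lemma set_integrable_iff:
  fixes k :: "real \<times> real \<Rightarrow> real"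
  shows "k \<in> borel_measurable lebesgue \<Longrightarrow> set_integrable lebesgue S k \<longleftrightarrow> integrable (uniform_measure lebesgue S) k"
  using S by (intro integrable_uniform_measure_iff[symmetric]) auto

lemma AE_on_iff: "(AE z in uniform_measure lebesgue S. P z) \<longleftrightarrow> (AE z in lebesgue. z \<in> S \<longrightarrow> P z)"
  using S by (intro AE_uniform_measure) (auto simp: measure_def less_top[symmetric])

lemma g_set_integrable: "set_integrable lebesgue S g"
  by (rule set_integrable_iff[THEN iffD2, OF g])

lemma avg_pos: "0 < avg S g"
  using expectation_greater[OF g(2) pos] g(1) by (simp add: avg_eq_expectation)

lemma powr_measurable: "(\<lambda>z. g z powr a) \<in> borel_measurable lebesgue"
  using g(1) by measurable

lemma moment_powr_iff:
  assumes "0 \<le> L"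
  shows "normalized_moment (\<lambda>x. x powr a) (uniform_measure lebesgue S) g \<le> ennreal L \<longleftrightarrow>
    set_integrable lebesgue S (\<lambda>z. g z powr a) \<and> avg S (\<lambda>z. g z powr a) \<le> L * avg S g powr a"
  using normalized_moment_powr_le_iff[OF g(2) pos assms, of a]
  by (simp add: set_integrable_iff avg_eq_expectation g powr_measurable)

lemma avg_powr_nonneg: "0 \<le> avg S (\<lambda>z. g z powr a)"
  unfolding avg_eq_expectation[OF powr_measurable] by (rule Bochner_Integration.integral_nonneg) simp

text \<open>Here r is p - 1. The moment bound says E \<le> L^(1/r) c^(-1/r); raising to the power r
  and multiplying by c gives the A_p product.\<close>

lemma moment_iff_Ap:
  assumes L: "0 \<le> L" and r: "0 < r"
  shows "normalized_moment (\<lambda>x. x powr (-1/r)) (uniform_measure lebesgue S) g \<le> ennreal (L powr (1/r)) \<longleftrightarrow>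
    set_integrable lebesgue S (\<lambda>z. g z powr (-1/r)) \<and> avg S g * (avg S (\<lambda>z. g z powr (-1/r))) powr r \<le> L"
proof -
  let ?c = "avg S g" and ?E = "avg S (\<lambda>z. g z powr (-1/r))"
  have c: "0 < ?c" by (rule avg_pos)
  have E: "0 \<le> ?E" by (rule avg_powr_nonneg)
  have "?E \<le> L powr (1/r) * ?c powr (-1/r) \<longleftrightarrow> ?E powr r \<le> (L powr (1/r) * ?c powr (-1/r)) powr r"
    using r E by (intro powr_le_iff[symmetric]) auto
  also have "(L powr (1/r) * ?c powr (-1/r)) powr r = L * inverse ?c"
  proof -
    have "(?c powr (-1/r)) powr r = ?c powr (-1/r * r)" by (rule powr_powr)
    also have "-1/r * r = -1" using r by simp
    finally have "(?c powr (-1/r)) powr r = inverse ?c" using c by (simp add: powr_minus)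
    moreover have "(L powr (1/r)) powr r = L" using r L by (simp add: powr_powr)
    ultimately show ?thesis by (simp only: powr_mult)
  qed
  also have "?E powr r \<le> L * inverse ?c \<longleftrightarrow> ?c * ?E powr r \<le> L"
    using c by (simp add: field_simps)
  finally show ?thesis by (simp add: moment_powr_iff)
qed

text \<open>The moment bound says E \<le> L^p c^p, and both sides are nonnegative, so p-th roots may
  be taken.\<close>

lemma moment_iff_RHp:
  assumes L: "0 \<le> L" and p: "0 < p"
  shows "normalized_moment (\<lambda>x. x powr p) (uniform_measure lebesgue S) g \<le> ennreal (L powr p) \<longleftrightarrow>
    set_integrable lebesgue S (\<lambda>z. g z powr p) \<and> (avg S (\<lambda>z. g z powr p)) powr (1/p) \<le> L * avg S g"
proof -
  let ?c = "avg S g" and ?E = "avg S (\<lambda>z. g z powr p)"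
  have c: "0 < ?c" by (rule avg_pos)
  have E: "0 \<le> ?E" by (rule avg_powr_nonneg)
  have "?E \<le> L powr p * ?c powr p \<longleftrightarrow> ?E powr (1/p) \<le> (L powr p * ?c powr p) powr (1/p)"
    using p E by (intro powr_le_iff[symmetric]) auto
  also have "(L powr p * ?c powr p) powr (1/p) = L * ?c"
    using p L c by (simp add: powr_mult powr_powr)
  finally show ?thesis by (simp add: moment_powr_iff)
qed

text \<open>L \<ge> 1 makes ln L nonnegative, so that \<open>ennreal (ln L)\<close> is not cut off
  at 0.\<close>

lemma moment_iff_Ainf:
  assumes L: "1 \<le> L"
  shows "normalized_moment (\<lambda>x. x - 1 - ln x) (uniform_measure lebesgue S) g \<le> ennreal (ln L) \<longleftrightarrow>
    set_integrable lebesgue S (\<lambda>z. ln (1 / g z)) \<and> avg S g * exp (avg S (\<lambda>z. ln (1 / g z))) \<le> L"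
proof -
  have "(\<lambda>z. ln (1 / g z)) \<in> borel_measurable lebesgue" using g(1) by measurable
  then show ?thesis
    using normalized_moment_ln_le_iff[OF g(2) pos, of "ln L"] L
    by (simp add: set_integrable_iff avg_eq_expectation g)
qed

text \<open>With x = g / c, the integrand vanishes precisely where L x \<ge> 1, that is, where c
  \<le> L g.\<close>

lemma moment_iff_A1:
  "normalized_moment (\<lambda>x. max 0 (1 - L * x)) (uniform_measure lebesgue S) g \<le> ennreal 0 \<longleftrightarrow>
    (AE z in lebesgue. z \<in> S \<longrightarrow> avg S g \<le> L * g z)"
proof -
  have "normalized_moment (\<lambda>x. max 0 (1 - L * x)) (uniform_measure lebesgue S) g \<le> ennreal 0 \<longleftrightarrow>
      (AE z in uniform_measure lebesgue S. max 0 (1 - L * (g z / expectation g)) \<le> 0)"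
    using normalized_moment_le_0_iff[of g "\<lambda>x. max 0 (1 - L * x)"] g(1) by simp
  also have "\<dots> \<longleftrightarrow> (AE z in uniform_measure lebesgue S. avg S g \<le> L * g z)"
    using avg_pos by (intro AE_cong) (simp add: avg_eq_expectation[OF g(1), symmetric] field_simps)
  finally show ?thesis by (simp only: AE_on_iff)
qed

lemma moment_iff_RHinf:
  "normalized_moment (\<lambda>x. max 0 (x - L)) (uniform_measure lebesgue S) g \<le> ennreal 0 \<longleftrightarrow>
    (AE z in lebesgue. z \<in> S \<longrightarrow> g z \<le> L * avg S g)"
proof -
  have "normalized_moment (\<lambda>x. max 0 (x - L)) (uniform_measure lebesgue S) g \<le> ennreal 0 \<longleftrightarrow>
      (AE z in uniform_measure lebesgue S. max 0 (g z / expectation g - L) \<le> 0)"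
    using normalized_moment_le_0_iff[of g "\<lambda>x. max 0 (x - L)"] g(1) by simp
  also have "\<dots> \<longleftrightarrow> (AE z in uniform_measure lebesgue S. g z \<le> L * avg S g)"
    using avg_pos by (intro AE_cong) (simp add: avg_eq_expectation[OF g(1), symmetric] field_simps)
  finally show ?thesis by (simp only: AE_on_iff)
qed

end

lemma weight_on_dyadic_rect:
  assumes f: "weight f" and D: "D \<in> dyadic_rects"
  shows "weight_on_set D (per f)"
proof
  show S: "D \<in> sets borel" "0 < measure lborel D"
    using D by (rule dyadic_rect_borel, rule dyadic_rect_measure_pos)
  then have Sl: "D \<in> sets lebesgue" "0 < measure lebesgue D" by simp_all
  show g: "per f \<in> borel_measurable lebesgue" by (rule weight_per_measurable[OF f])
  have "set_integrable lebesgue D (per f)"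
    using f Sl dyadic_rect_subset[OF D] unfolding weight_def by (blast intro: set_integrable_subset)
  then show "integrable (uniform_measure lebesgue D) (per f)"
    using Sl g by (simp add: integrable_uniform_measure_iff)
  have "AE z in lebesgue. z \<in> D \<longrightarrow> 0 < per f z"
    using f dyadic_rect_subset[OF D] unfolding weight_def by (auto elim!: eventually_mono)
  then show "AE z in uniform_measure lebesgue D. 0 < per f z"
    using Sl(1) by (rule AE_uniform_measureI[rotated])
qed

section \<open>The five conditions for the average, with explicit constants\<close>

lemma convex_on_max_0:
  fixes f :: "real \<Rightarrow> real"
  assumes "convex_on S f" shows "convex_on S (\<lambda>x. max 0 (f x))"
proof (rule convex_onI)
  show "convex S" using assms by (rule convex_on_imp_convex)
  fix t x y assume t: "0 < t" "t < (1::real)" and xy: "x \<in> S" "y \<in> S"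
  have "f ((1 - t) *\<^sub>R x + t *\<^sub>R y) \<le> (1 - t) * f x + t * f y"
    using assms t xy by (intro convex_onD) auto
  also have "\<dots> \<le> (1 - t) * max 0 (f x) + t * max 0 (f y)"
    using t by (intro add_mono mult_left_mono) auto
  finally show "max 0 (f ((1 - t) *\<^sub>R x + t *\<^sub>R y)) \<le> (1 - t) * max 0 (f x) + t * max 0 (f y)"
    using t by auto
qed

definition averaged_family :: "real \<Rightarrow> (real \<Rightarrow> real \<Rightarrow> real \<Rightarrow> real \<Rightarrow> real) \<Rightarrow> bool" where
  "averaged_family C W \<longleftrightarrow> joint_ok W \<and> (\<forall>s\<in>{0..1}. \<forall>t\<in>{0..1}. weight (W s t) \<and> doubling C (per (W s t)))"

text \<open>The moment premise may assume \<open>weight_on_set\<close>, so the equivalences of that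
  locale apply on dyadic rectangles; the first conclusion makes them available for the
  average.\<close>

lemma average_moment_bound:
  assumes W: "averaged_family C W"
    and \<phi>: "\<phi> \<in> borel_measurable borel" "\<psi> \<in> borel_measurable borel"
      "\<And>x. 0 < x \<Longrightarrow> 0 \<le> \<phi> x" "\<And>x. 0 < x \<Longrightarrow> 0 \<le> \<psi> x" "convex_on {0<..} \<psi>"
    and AB: "0 \<le> A" "0 \<le> B" "0 \<le> K"
    and moment: "\<And>s t D. s \<in> {0..1} \<Longrightarrow> t \<in> {0..1} \<Longrightarrow> D \<in> dyadic_rects \<Longrightarrow> weight_on_set D (per (W s t)) \<Longrightarrow>
      normalized_moment \<phi> (uniform_measure lebesgue D) (per (W s t)) \<le> ennreal K"
    and M: "M = 256 * max C 1 ^ 6"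
    and dilate: "\<And>q x. 1 / M \<le> q \<Longrightarrow> q \<le> M \<Longrightarrow> 0 < x \<Longrightarrow> \<psi> (q * x) \<le> A * \<phi> x + B * (x + 1)"
    and R: "R \<in> torus_rects"
  shows "weight_on_set R (per (avgw W))"
    and "normalized_moment \<psi> (uniform_measure lebesgue R) (per (avgw W)) \<le> ennreal (5 * (A * K + 2 * B))"
proof -
  have wt: "weight (W s t)" "doubling C (per (W s t))" if "s \<in> {0..1}" "t \<in> {0..1}" for s t
    using W that unfolding averaged_family_def by auto
  have mom: "normalized_moment \<phi> (uniform_measure lebesgue D) (per (W s t)) \<le> ennreal K"
    if "s \<in> {0..1}" "t \<in> {0..1}" "D \<in> dyadic_rects" for s t D
    using moment[OF that weight_on_dyadic_rect[OF wt(1)[OF that(1,2)] that(3)]] .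
  have W': "joint_ok W" using W unfolding averaged_family_def by auto
  note avg = normalized_moment_avgw[OF W' wt \<phi> AB mom M dilate R]
  show "weight_on_set R (per (avgw W))"
    using avg(1-3) torus_rect_borel[OF R] torus_rect_measure_pos[OF R] by unfold_locales
  show "normalized_moment \<psi> (uniform_measure lebesgue R) (per (avgw W)) \<le> ennreal (5 * (A * K + 2 * B))"
    by (rule avg(4))
qed

text \<open>Bounds, in both directions, the ratio of the means of a doubling weight over a rectangle
  and over a dyadic piece of its cover: 256 accounts for areas, six doublings for integrals.\<close>

definition dilation_bound :: "real \<Rightarrow> real" where
  "dilation_bound C = 256 * max C 1 ^ 6"

lemma dilation_bound_ge_1: "1 \<le> dilation_bound C"
proof -
  have "1 \<le> max C 1 ^ 6" by (rule one_le_power) simp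
  then show ?thesis unfolding dilation_bound_def by linarith
qed

text \<open>Since M q \<ge> 1, V x \<ge> 1 implies M V q x \<ge> 1 for nonnegative V, so a zero
  moment stays zero when V becomes M V. The positive part of V keeps this monotone for every sign of
  V.\<close>

lemma average_A1:
  assumes W: "averaged_family C W"
    and d: "\<And>s t. s \<in> {0..1} \<Longrightarrow> t \<in> {0..1} \<Longrightarrow> Ap_cond 1 V dyadic_rects (per (W s t))"
  shows "Ap_cond 1 (dilation_bound C * max V 0) torus_rects (per (avgw W))"
proof -
  let ?M = "dilation_bound C"
  let ?\<phi> = "\<lambda>x::real. max 0 (1 - V * x)" and ?\<psi> = "\<lambda>x::real. max 0 (1 - ?M * max V 0 * x)"
  have dil: "?\<psi> (q * x) \<le> 1 * ?\<phi> x + 0 * (x + 1)" if q: "1 / ?M \<le> q" and x: "0 < x" for q x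
  proof -
    have "V * x \<le> max V 0 * x * 1" using x by (simp add: mult_right_mono)
    also have "\<dots> \<le> max V 0 * x * (?M * q)"
      using q x dilation_bound_ge_1[of C] by (intro mult_left_mono) (auto simp: field_simps)
    finally show ?thesis by (simp add: ac_simps)
  qed
  have conv: "convex_on {0<..} ?\<psi>"
  proof (rule convex_on_max_0)
    show "convex_on {0<..} (\<lambda>x. 1 - ?M * max V 0 * x)"
      by (rule convex_onI) (auto simp: algebra_simps)
  qed
  have mom: "normalized_moment ?\<phi> (uniform_measure lebesgue D) (per (W s t)) \<le> ennreal 0"
    if "s \<in> {0..1}" "t \<in> {0..1}" "D \<in> dyadic_rects" "weight_on_set D (per (W s t))" for s t D
    using d[OF that(1,2)] that(3) weight_on_set.moment_iff_A1[OF that(4), of V]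
    unfolding Ap_cond_def by simp
  have "set_integrable lebesgue R (per (avgw W)) \<and>
      (AE z in lebesgue. z \<in> R \<longrightarrow> avg R (per (avgw W)) \<le> ?M * max V 0 * per (avgw W) z)" if R: "R \<in> torus_rects" for R
  proof -
    note b = average_moment_bound[where A = 1 and B = 0 and K = 0 and \<phi> = ?\<phi> and \<psi> = ?\<psi>,
        OF W _ _ _ _ conv _ _ _ mom dilation_bound_def dil R]
    interpret weight_on_set R "per (avgw W)" by (rule b(1)) auto
    have "normalized_moment ?\<psi> (uniform_measure lebesgue R) (per (avgw W)) \<le> ennreal (5 * (1 * 0 + 2 * 0))"
      by (rule b(2)) auto
    then show ?thesis
      using moment_iff_A1[of "?M * max V 0"] g_set_integrable by simp
  qed
  then show ?thesis unfolding Ap_cond_def by simp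
qed

text \<open>The logarithm turns a dilation into an additive error: - ln q \<le> ln M \<le> M and q x
  \<le> M x, so B = M absorbs both. This is the case for which the term B (x + 1) is
  provided.\<close>

lemma average_Ainf:
  assumes W: "averaged_family C W"
    and d: "\<And>s t. s \<in> {0..1} \<Longrightarrow> t \<in> {0..1} \<Longrightarrow> Ap_cond \<infinity> V dyadic_rects (per (W s t))"
  shows "Ap_cond \<infinity> (exp (5 * (ln (max V 1) + 2 * dilation_bound C))) torus_rects (per (avgw W))"
proof -
  let ?M = "dilation_bound C" and ?K = "ln (max V 1)"
  let ?\<phi> = "\<lambda>x::real. x - 1 - ln x"
  have M: "1 \<le> ?M" by (rule dilation_bound_ge_1)
  have nonneg: "0 \<le> ?\<phi> x" if "0 < x" for x using ln_le_minus_one[OF that] by simp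
  have dil: "?\<phi> (q * x) \<le> 1 * ?\<phi> x + ?M * (x + 1)" if q: "1 / ?M \<le> q" "q \<le> ?M" and x: "0 < x" for q x
  proof -
    have q0: "0 < q" using q(1) M by (meson divide_pos_pos less_le_trans zero_less_one)
    have "- ln q \<le> ln ?M"
      using q(1) q0 M by (simp add: ln_div[symmetric] ln_mult[symmetric] field_simps flip: ln_inverse)
    also have "\<dots> \<le> ?M" using ln_le_minus_one[of ?M] M by simp
    finally have 1: "- ln q \<le> ?M" .
    have 2: "q * x \<le> ?M * x" using q(2) x by (intro mult_right_mono) auto
    have eqs: "ln (q * x) = ln q + ln x" "?M * (x + 1) = ?M * x + ?M"
      using q0 x by (simp_all add: ln_mult algebra_simps)
    have "u - 1 - (a + b) \<le> 1 * (x - 1 - b) + (v + m)" if "- a \<le> m" "u \<le> v" for u v a b m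
      using that x by simp
    from this[OF 1 2] show ?thesis unfolding eqs .
  qed
  have conv: "convex_on {0<..} ?\<phi>"
  proof (rule f''_ge0_imp_convex)
    show "convex {(0::real)<..}" by auto
    show "(?\<phi> has_real_derivative 1 - 1 / x) (at x)" if "x \<in> {0<..}" for x
      using that by (auto intro!: derivative_eq_intros)
    show "((\<lambda>x. 1 - 1 / x) has_real_derivative 1 / x^2) (at x)" if "x \<in> {0<..}" for x :: real
      using that by (auto intro!: derivative_eq_intros simp: power2_eq_square)
  qed auto
  \<comment> \<open>The equivalence asks for a constant at least 1, so V is enlarged to
    \<open>max V 1\<close>.\<close>
  have mom: "normalized_moment ?\<phi> (uniform_measure lebesgue D) (per (W s t)) \<le> ennreal ?K"
    if "s \<in> {0..1}" "t \<in> {0..1}" "D \<in> dyadic_rects" "weight_on_set D (per (W s t))" for s t D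
    using d[OF that(1,2)] that(3) weight_on_set.moment_iff_Ainf[OF that(4), of "max V 1"]
    unfolding Ap_cond_def by (simp add: max_def) (meson order_trans less_imp_le not_le)
  let ?L = "exp (5 * (?K + 2 * ?M))"
  have K: "0 \<le> ?K" by simp
  have "set_integrable lebesgue R (per (avgw W)) \<and> set_integrable lebesgue R (\<lambda>z. ln (1 / per (avgw W) z)) \<and>
      avg R (per (avgw W)) * exp (avg R (\<lambda>z. ln (1 / per (avgw W) z))) \<le> ?L" if R: "R \<in> torus_rects" for R
  proof -
    note b = average_moment_bound[where A = 1 and B = ?M and K = ?K and \<phi> = ?\<phi> and \<psi> = ?\<phi>,
        OF W _ _ nonneg nonneg conv _ _ _ mom dilation_bound_def dil R]
    interpret weight_on_set R "per (avgw W)" by (rule b(1)) (use M K in auto)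
    have "normalized_moment ?\<phi> (uniform_measure lebesgue R) (per (avgw W)) \<le> ennreal (5 * (1 * ?K + 2 * ?M))"
      by (rule b(2)) (use M K in auto)
    then show ?thesis
      using moment_iff_Ainf[of ?L] g_set_integrable M K by simp
  qed
  then show ?thesis unfolding Ap_cond_def by simp
qed

text \<open>As -1/r is negative, the lower bound on q gives the dilation factor M^(1/r). The outer
  power r undoes the roots: for V \<ge> 0 the constant is 5^r M V.\<close>

lemma average_Ap:
  assumes W: "averaged_family C W" and r: "0 < r"
    and d: "\<And>s t. s \<in> {0..1} \<Longrightarrow> t \<in> {0..1} \<Longrightarrow> Ap_cond (ereal (r + 1)) V dyadic_rects (per (W s t))"
  shows "Ap_cond (ereal (r + 1)) ((5 * (dilation_bound C powr (1/r) * max V 0 powr (1/r))) powr r) torus_rects (per (avgw W))"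
proof -
  let ?M = "dilation_bound C" and ?V = "max V 0"
  let ?\<phi> = "\<lambda>x::real. x powr (-1/r)" and ?L = "(5 * (dilation_bound C powr (1/r) * max V 0 powr (1/r))) powr r"
  have M: "1 \<le> ?M" by (rule dilation_bound_ge_1)
  have dil: "?\<phi> (q * x) \<le> ?M powr (1/r) * ?\<phi> x + 0 * (x + 1)" if q: "1 / ?M \<le> q" and x: "0 < x" for q x
  proof -
    have q0: "0 < q" using q M by (meson divide_pos_pos less_le_trans zero_less_one)
    have "q powr (-1/r) \<le> (1 / ?M) powr (-1/r)"
      using q r M by (intro powr_mono2') auto
    also have "\<dots> = ?M powr (1/r)" using M by (simp add: powr_divide powr_minus_divide)
    finally have "q powr (-1/r) * x powr (-1/r) \<le> ?M powr (1/r) * x powr (-1/r)" by (rule mult_right_mono) simp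
    then show ?thesis using q0 x by (simp add: powr_mult)
  qed
  have conv: "convex_on {0<..} ?\<phi>" using r by (intro convex_on_powr_nonpos) simp
  have p: "ereal (r + 1) \<noteq> \<infinity>" "ereal (r + 1) \<noteq> 1" using r by (auto simp: one_ereal_def)
  have mom: "normalized_moment ?\<phi> (uniform_measure lebesgue D) (per (W s t)) \<le> ennreal (?V powr (1/r))"
    if "s \<in> {0..1}" "t \<in> {0..1}" "D \<in> dyadic_rects" "weight_on_set D (per (W s t))" for s t D
  proof -
    have "set_integrable lebesgue D (\<lambda>z. per (W s t) z powr (-1/r))"
      "avg D (per (W s t)) * avg D (\<lambda>z. per (W s t) z powr (-1/r)) powr r \<le> V"
      using d[OF that(1,2)] that(3) p unfolding Ap_cond_def by auto
    then show ?thesis using weight_on_set.moment_iff_Ap[OF that(4) _ r, of ?V] by auto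
  qed
  have "set_integrable lebesgue R (per (avgw W)) \<and> set_integrable lebesgue R (\<lambda>z. per (avgw W) z powr (-1/r)) \<and>
      avg R (per (avgw W)) * avg R (\<lambda>z. per (avgw W) z powr (-1/r)) powr r \<le> ?L" if R: "R \<in> torus_rects" for R
  proof -
    note b = average_moment_bound[where A = "?M powr (1/r)" and B = 0 and K = "?V powr (1/r)" and \<phi> = ?\<phi> and \<psi> = ?\<phi>,
        OF W _ _ _ _ conv _ _ _ mom dilation_bound_def dil R]
    interpret weight_on_set R "per (avgw W)" by (rule b(1)) auto
    have "normalized_moment ?\<phi> (uniform_measure lebesgue R) (per (avgw W)) \<le> ennreal (5 * (?M powr (1/r) * ?V powr (1/r) + 2 * 0))"
      by (rule b(2)) auto
    also have "5 * (?M powr (1/r) * ?V powr (1/r) + 2 * 0) = ?L powr (1/r)" using r by (simp add: powr_powr)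
    finally show ?thesis
      using moment_iff_Ap[OF _ r, of ?L] g_set_integrable by simp
  qed
  then show ?thesis unfolding Ap_cond_def using p by simp
qed

text \<open>For V \<ge> 0 the upper bound on q gives q x - M V \<le> M (x - V), so A = M, and the
  zero moment is preserved.\<close>

lemma average_RHinf:
  assumes W: "averaged_family C W"
    and d: "\<And>s t. s \<in> {0..1} \<Longrightarrow> t \<in> {0..1} \<Longrightarrow> RH_cond \<infinity> V dyadic_rects (per (W s t))"
  shows "RH_cond \<infinity> (dilation_bound C * max V 0) torus_rects (per (avgw W))"
proof -
  let ?M = "dilation_bound C"
  let ?\<phi> = "\<lambda>x::real. max 0 (x - V)" and ?\<psi> = "\<lambda>x::real. max 0 (x - ?M * max V 0)"
  have M: "1 \<le> ?M" by (rule dilation_bound_ge_1)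
  have dil: "?\<psi> (q * x) \<le> ?M * ?\<phi> x + 0 * (x + 1)" if q: "q \<le> ?M" and x: "0 < x" for q x
  proof -
    have "q * x - ?M * max V 0 \<le> ?M * (x - max V 0)"
      using mult_right_mono[OF q, of x] x by (simp add: algebra_simps)
    also have "\<dots> \<le> ?M * ?\<phi> x" using M by (intro mult_left_mono) auto
    finally show ?thesis using M by simp
  qed
  have conv: "convex_on {0<..} ?\<psi>"
  proof (rule convex_on_max_0)
    show "convex_on {0<..} (\<lambda>x. x - ?M * max V 0)"
      by (rule convex_onI) (auto simp: algebra_simps)
  qed
  have mom: "normalized_moment ?\<phi> (uniform_measure lebesgue D) (per (W s t)) \<le> ennreal 0"
    if "s \<in> {0..1}" "t \<in> {0..1}" "D \<in> dyadic_rects" "weight_on_set D (per (W s t))" for s t D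
    using d[OF that(1,2)] that(3) weight_on_set.moment_iff_RHinf[OF that(4), of V]
    unfolding RH_cond_def by simp
  have "set_integrable lebesgue R (per (avgw W)) \<and>
      (AE z in lebesgue. z \<in> R \<longrightarrow> per (avgw W) z \<le> ?M * max V 0 * avg R (per (avgw W)))" if R: "R \<in> torus_rects" for R
  proof -
    note b = average_moment_bound[where A = ?M and B = 0 and K = 0 and \<phi> = ?\<phi> and \<psi> = ?\<psi>,
        OF W _ _ _ _ conv _ _ _ mom dilation_bound_def dil R]
    interpret weight_on_set R "per (avgw W)" by (rule b(1)) (use M in auto)
    have "normalized_moment ?\<psi> (uniform_measure lebesgue R) (per (avgw W)) \<le> ennreal (5 * (?M * 0 + 2 * 0))"
      by (rule b(2)) (use M in auto)
    then show ?thesis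
      using moment_iff_RHinf[of "?M * max V 0"] g_set_integrable by simp
  qed
  then show ?thesis unfolding RH_cond_def by simp
qed

text \<open>The upper bound on q gives the dilation factor M^p; after the p-th root the constant is
  5^(1/p) M V for V \<ge> 0.\<close>

lemma average_RHp:
  assumes W: "averaged_family C W" and p: "1 < p"
    and d: "\<And>s t. s \<in> {0..1} \<Longrightarrow> t \<in> {0..1} \<Longrightarrow> RH_cond (ereal p) V dyadic_rects (per (W s t))"
  shows "RH_cond (ereal p) ((5 * (dilation_bound C powr p * max V 0 powr p)) powr (1/p)) torus_rects (per (avgw W))"
proof -
  let ?M = "dilation_bound C" and ?V = "max V 0"
  let ?\<phi> = "\<lambda>x::real. x powr p" and ?L = "(5 * (dilation_bound C powr p * max V 0 powr p)) powr (1/p)"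
  have M: "1 \<le> ?M" by (rule dilation_bound_ge_1)
  have p0: "0 < p" using p by simp
  have dil: "?\<phi> (q * x) \<le> ?M powr p * ?\<phi> x + 0 * (x + 1)" if q: "1 / ?M \<le> q" "q \<le> ?M" and x: "0 < x" for q x
  proof -
    have q0: "0 < q" using q(1) M by (meson divide_pos_pos less_le_trans zero_less_one)
    have "q powr p \<le> ?M powr p" using q q0 p by (intro powr_mono2) auto
    then have "q powr p * x powr p \<le> ?M powr p * x powr p" by (rule mult_right_mono) simp
    then show ?thesis using q0 x by (simp add: powr_mult)
  qed
  have conv: "convex_on {0<..} ?\<phi>" using p by (intro powr_convex) simp
  have mom: "normalized_moment ?\<phi> (uniform_measure lebesgue D) (per (W s t)) \<le> ennreal (?V powr p)"
    if "s \<in> {0..1}" "t \<in> {0..1}" "D \<in> dyadic_rects" "weight_on_set D (per (W s t))" for s t D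
  proof -
    have *: "set_integrable lebesgue D (\<lambda>z. per (W s t) z powr p)"
      "avg D (\<lambda>z. per (W s t) z powr p) powr (1/p) \<le> V * avg D (per (W s t))"
      using d[OF that(1,2)] that(3) unfolding RH_cond_def by auto
    have "V * avg D (per (W s t)) \<le> ?V * avg D (per (W s t))"
      using weight_on_set.avg_pos[OF that(4)] by (intro mult_right_mono) auto
    then show ?thesis using * weight_on_set.moment_iff_RHp[OF that(4) _ p0, of ?V] by auto
  qed
  have "set_integrable lebesgue R (per (avgw W)) \<and> set_integrable lebesgue R (\<lambda>z. per (avgw W) z powr p) \<and>
      avg R (\<lambda>z. per (avgw W) z powr p) powr (1/p) \<le> ?L * avg R (per (avgw W))" if R: "R \<in> torus_rects" for R
  proof -
    note b = average_moment_bound[where A = "?M powr p" and B = 0 and K = "?V powr p" and \<phi> = ?\<phi> and \<psi> = ?\<phi>,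
        OF W _ _ _ _ conv _ _ _ mom dilation_bound_def dil R]
    interpret weight_on_set R "per (avgw W)" by (rule b(1)) auto
    have "normalized_moment ?\<phi> (uniform_measure lebesgue R) (per (avgw W)) \<le> ennreal (5 * (?M powr p * ?V powr p + 2 * 0))"
      by (rule b(2)) auto
    also have "5 * (?M powr p * ?V powr p + 2 * 0) = ?L powr p" using p0 by (simp add: powr_powr)
    finally show ?thesis
      using moment_iff_RHp[OF _ p0, of ?L] g_set_integrable by simp
  qed
  then show ?thesis unfolding RH_cond_def by simp
qed

text \<open>The constants found above are expressions in Cdbl, V and p alone, so K can be fixed
  before W; what remains is to split on p infinite, p = 1 and p strictly between.\<close>

theorem mainTheorem8:
  fixes Cdbl V :: real and p :: ereal
  shows
  "(1 \<le> p \<longrightarrow> (\<exists>K::real. \<forall>W. joint_ok W \<and>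
       (\<forall>s\<in>{0..1}. \<forall>t\<in>{0..1}. weight (W s t) \<and> doubling Cdbl (per (W s t))
          \<and> Ap_cond p V dyadic_rects (per (W s t)))
     \<longrightarrow> Ap_cond p K torus_rects (per (avgw W))))
 \<and> (1 < p \<longrightarrow> (\<exists>K::real. \<forall>W. joint_ok W \<and>
       (\<forall>s\<in>{0..1}. \<forall>t\<in>{0..1}. weight (W s t) \<and> doubling Cdbl (per (W s t))
          \<and> RHd_cond p V (per (W s t)))
     \<longrightarrow> RH_cond p K torus_rects (per (avgw W))))"
proof (intro conjI impI)
  assume p: "1 \<le> p"
  have "\<exists>K. \<forall>W. averaged_family Cdbl W \<and> (\<forall>s\<in>{0..1}. \<forall>t\<in>{0..1}. Ap_cond p V dyadic_rects (per (W s t)))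
      \<longrightarrow> Ap_cond p K torus_rects (per (avgw W))"
  proof (cases p)
    case PInf
    then show ?thesis using average_Ainf[where C = Cdbl and V = V] by metis
  next
    case (real r)
    show ?thesis
    proof (cases "r = 1")
      case True
      then show ?thesis using average_A1[where C = Cdbl and V = V] real by (metis one_ereal_def)
    next
      case False
      then have r: "0 < r - 1" using p real by (simp add: one_ereal_def)
      have "p = ereal ((r - 1) + 1)" using real by simp
      then show ?thesis using average_Ap[OF _ r, where C = Cdbl and V = V] by metis
    qed
  qed (use p in auto)
  then show "\<exists>K::real. \<forall>W. joint_ok W \<and>
       (\<forall>s\<in>{0..1}. \<forall>t\<in>{0..1}. weight (W s t) \<and> doubling Cdbl (per (W s t))
          \<and> Ap_cond p V dyadic_rects (per (W s t)))
     \<longrightarrow> Ap_cond p K torus_rects (per (avgw W))"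
    unfolding averaged_family_def by (elim exE) (intro exI allI impI, blast)
next
  assume p: "1 < p"
  have "\<exists>K. \<forall>W. averaged_family Cdbl W \<and> (\<forall>s\<in>{0..1}. \<forall>t\<in>{0..1}. RH_cond p V dyadic_rects (per (W s t)))
      \<longrightarrow> RH_cond p K torus_rects (per (avgw W))"
  proof (cases p)
    case PInf
    then show ?thesis using average_RHinf[where C = Cdbl and V = V] by metis
  next
    case (real r)
    then have r: "1 < r" using p by (simp add: one_ereal_def)
    show ?thesis using average_RHp[OF _ r, where C = Cdbl and V = V] real by metis
  qed (use p in auto)
  then show "\<exists>K::real. \<forall>W. joint_ok W \<and>
       (\<forall>s\<in>{0..1}. \<forall>t\<in>{0..1}. weight (W s t) \<and> doubling Cdbl (per (W s t))
          \<and> RHd_cond p V (per (W s t)))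
     \<longrightarrow> RH_cond p K torus_rects (per (avgw W))"
    unfolding averaged_family_def RHd_cond_def by (elim exE) (intro exI allI impI, blast)
qed

end
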